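(* One can choose, for every prime power $q$ and every integer $n \ge 1$, a map $\rho_q^n\colon \mathbb{F}_{q^n} \to \mathbb{F}_q^{n\times n}$ that is an injective $\mathbb{F}_q$-algebra homomorphism (hence a field embedding), in such a way that the whole family is globally compatible in the following sense. For every prime power $q$ and all integers $m, n \ge 1$, the composition $$\mathbb{F}_{q^{nm}} \xrightarrow{\ \rho_{q^n}^m\ } \mathbb{F}_{q^n}^{m\times m} \xrightarrow{\ \rho_q^n \text{ applied to each entry}\ } (\mathbb{F}_q^{n\times n})^{m\times m} \cong \mathbb{F}_q^{nm\times nm}$$ coincides with $\rho_q^{nm}\colon \mathbb{F}_{q^{nm}} \to \mathbb{F}_q^{nm\times nm}$ up to row and column permutations; that is, there is a permutation matrix $Q \in \{0,1\}^{nm\times nm}$, depending only on $q, n, m$, such that for every $\xi \in \mathbb{F}_{q^{nm}}$ the image of $\xi$ under this composition equals $Q\,\rho_q^{nm}(\xi)\,Q^\top$.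
   Context: For each prime $p$, fix an algebraic closure of $\mathbb{F}_p$ and let $\mathbb{F}_{p^k}$ denote its unique subfield with $p^k$ elements, so that $\mathbb{F}_{p^d} \subseteq \mathbb{F}_{p^k}$ whenever $d \mid k$. For a field $K$, $K^{n\times n}$ is the $K$-algebra of $n \times n$ matrices over $K$. The identification $(K^{n\times n})^{m\times m} \cong K^{nm\times nm}$ is the block-matrix one: with $0 \le \ddot\imath, \ddot\jmath < m$ and $0 \le i, j < n$, the $(i,j)$-entry of the $(\ddot\imath, \ddot\jmath)$-block becomes the $(\ddot\imath n + i, \ddot\jmath n + j)$-entry. *)

theory Defs
  imports
    "Jordan_Normal_Form.Matrix"
    "HOL-Algebra.Algebraic_Closure"
    "HOL-Number_Theory.Residues"
    "HOL-Number_Theory.Prime_Powers"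
    "HOL-Combinatorics.Permutations"
begin

definition alg_closure_of_prime_field :: "nat \<Rightarrow> ('a, 'b) ring_scheme \<Rightarrow> bool" where
  "alg_closure_of_prime_field p R \<longleftrightarrow>
     (\<exists>h \<in> Ring.ring_hom (residue_ring (int p)) R.
        algebraic_closure R (h ` carrier (residue_ring (int p))))"

text \<open>
  \<open>L p\<close> is the chosen algebraic closure of the prime field with \<open>p\<close> elements. For a prime power
  \<open>q\<close>, \<open>aprimedivisor q\<close> is the prime of which \<open>q\<close> is a power, so \<open>GF L q\<close> is the unique subfield
  of the corresponding closure with \<open>q\<close> elements, and \<open>GF L q\<close>, \<open>GF L (q ^ n)\<close> lie in the same
  closure.
\<close>

definition GF :: "(nat \<Rightarrow> ('a, 'b) ring_scheme) \<Rightarrow> nat \<Rightarrow> ('a, 'b) ring_scheme" where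
  "GF L q = (let R = L (aprimedivisor q)
             in R\<lparr>carrier := THE K. subfield K R \<and> card K = q\<rparr>)"

text \<open>
  The library locale \<open>algebra\<close> only covers commutative algebras, so algebras are used here only
  through the record type \<open>module\<close>.
\<close>

definition field_algebra :: "('a, 'b) ring_scheme \<Rightarrow> ('a, 'a) module" where
  "field_algebra E =
     \<lparr>carrier = carrier E, monoid.mult = monoid.mult E, one = \<one>\<^bsub>E\<^esub>,
      zero = \<zero>\<^bsub>E\<^esub>, add = add E, smult = monoid.mult E\<rparr>"

definition mat_algebra :: "('a, 'b) ring_scheme \<Rightarrow> nat \<Rightarrow> ('a, 'a mat) module" where
  "mat_algebra K n =
     \<lparr>carrier = {A \<in> carrier_mat n n. \<forall>i<n. \<forall>j<n. A $$ (i, j) \<in> carrier K},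
      monoid.mult = (\<lambda>A B. mat n n (\<lambda>(i, j). \<Oplus>\<^bsub>K\<^esub>k\<in>{..<n}. A $$ (i, k) \<otimes>\<^bsub>K\<^esub> B $$ (k, j))),
      one = mat n n (\<lambda>(i, j). if i = j then \<one>\<^bsub>K\<^esub> else \<zero>\<^bsub>K\<^esub>),
      zero = mat n n (\<lambda>_. \<zero>\<^bsub>K\<^esub>),
      add = (\<lambda>A B. mat n n (\<lambda>(i, j). A $$ (i, j) \<oplus>\<^bsub>K\<^esub> B $$ (i, j))),
      smult = (\<lambda>c A. mat n n (\<lambda>(i, j). c \<otimes>\<^bsub>K\<^esub> A $$ (i, j)))\<rparr>"

definition algebra_hom ::
    "('k, 'r) ring_scheme \<Rightarrow> ('k, 'a, 's) module_scheme \<Rightarrow> ('k, 'b, 't) module_scheme \<Rightarrow> ('a \<Rightarrow> 'b) set"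
  where
  "algebra_hom K A B =
     {h \<in> Ring.ring_hom A B. \<forall>c \<in> carrier K. \<forall>x \<in> carrier A. h (c \<odot>\<^bsub>A\<^esub> x) = c \<odot>\<^bsub>B\<^esub> h x}"

definition flatten_blocks :: "nat \<Rightarrow> nat \<Rightarrow> 'a mat mat \<Rightarrow> 'a mat" where
  "flatten_blocks m n M =
     mat (n * m) (n * m) (\<lambda>(r, c). (M $$ (r div n, c div n)) $$ (r mod n, c mod n))"

lemma flatten_blocks_entry:
  assumes "I < m" "J < m" "i < n" "j < n"
  shows "flatten_blocks m n M $$ (I * n + i, J * n + j) = (M $$ (I, J)) $$ (i, j)"
proof -
  have lt: "I' * n + i' < n * m" if "I' < m" "i' < n" for I' i'
  proof -
    have "I' * n + i' < Suc I' * n" using that by simp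
    also have "\<dots> \<le> m * n" using that by (intro mult_right_mono) auto
    finally show ?thesis by (simp add: mult.commute)
  qed
  show ?thesis using lt[OF assms(1,3)] lt[OF assms(2,4)] assms by (simp add: flatten_blocks_def)
qed

definition permutation_matrix :: "('a, 'b) ring_scheme \<Rightarrow> nat \<Rightarrow> 'a mat \<Rightarrow> bool" where
  "permutation_matrix K N Q \<longleftrightarrow>
     (\<exists>\<pi>. \<pi> permutes {..<N} \<and> Q = mat N N (\<lambda>(i, j). if i = \<pi> j then \<one>\<^bsub>K\<^esub> else \<zero>\<^bsub>K\<^esub>))"

end

theory Submission
  imports Defs
begin

text \<open>
  Each \<open>\<rho>\<^sub>q\<^sup>n\<close> is the regular representation of the field with \<open>q\<^sup>n\<close> elements in a basis over the
  field with \<open>q\<close> elements. If the basis at level \<open>nm\<close> is, as a set, the product of the basis from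
  \<open>q\<close> to \<open>q\<^sup>n\<close> and the basis from \<open>q\<^sup>n\<close> to \<open>q\<^sup>n\<^sup>m\<close>, then the composition and \<open>\<rho>\<^sub>q\<^sup>n\<^sup>m\<close> differ only by
  the order of the basis. Such bases are obtained as follows: for every prime power \<open>t\<close> of a prime
  \<open>l\<close> choose a generator \<open>x\<^sub>t\<close> of the field with \<open>p\<^sup>t\<close> elements; between \<open>p\<^sup>k\<close> and \<open>p\<^sup>N\<close> take all
  products of powers \<open>x\<^sub>t\<^sup>i\<close>, \<open>i < l\<close>, where \<open>t\<close> runs through the prime powers that divide \<open>N\<close> but
  not \<open>k\<close>. A step \<open>N = k l\<close> adds a single \<open>t\<close>, and \<open>1, \<dots>, x\<^sub>t\<^sup>l\<^sup>-\<^sup>1\<close> are independent because the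
  iterates of the Frobenius map \<open>x \<mapsto> x\<^bsup>p^k\<^esup>\<close> provide \<open>l\<close> distinct roots of any polynomial relation.
\<close>

section \<open>The Frobenius map\<close>

lemma (in cring) binomial:
  assumes x: "x \<in> carrier R" and y: "y \<in> carrier R"
  shows "(x \<oplus> y) [^] n = (\<Oplus>k\<in>{..n}. [(n choose k)] \<cdot> (x [^] k \<otimes> y [^] (n - k)))"
proof (induction n)
  case 0
  then show ?case using x y by simp
next
  case (Suc n)
  define T where "T n k = [(n choose k)] \<cdot> (x [^] k \<otimes> y [^] (n - k))" for n k :: nat
  have T: "T n k \<in> carrier R" for n k using x y by (simp add: T_def)
  have T_zero: "T n k = \<zero>" if "n < k" for n k using that by (simp add: T_def binomial_eq_0)
  have step0: "T (Suc n) 0 = y \<otimes> T n 0" using x y by (simp add: T_def m_comm)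
  have step: "T (Suc n) (Suc k) = x \<otimes> T n k \<oplus> y \<otimes> T n (Suc k)" if "k \<le> n" for k
  proof -
    have 1: "x \<otimes> T n k = [(n choose k)] \<cdot> (x [^] Suc k \<otimes> y [^] (n - k))"
      using x y by (simp add: T_def add_pow_rdistr m_ac)
    have 2: "y \<otimes> T n (Suc k) = [(n choose Suc k)] \<cdot> (x [^] Suc k \<otimes> y [^] (n - k))"
    proof (cases "k < n")
      case True
      hence "n - k = Suc (n - Suc k)" by simp
      thus ?thesis using x y by (simp add: T_def add_pow_rdistr m_ac)
    next
      case False
      thus ?thesis using x y by (simp add: T_def binomial_eq_0)
    qed
    show ?thesis unfolding 1 2 using x y by (simp add: T_def add.nat_pow_mult)
  qed
  have IH: "(x \<oplus> y) [^] n = (\<Oplus>k\<in>{..n}. T n k)" using Suc.IH by (simp add: T_def)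
  have tail: "(\<Oplus>k\<in>{..n}. T n (Suc k)) \<oplus> T n 0 = (\<Oplus>k\<in>{..n}. T n k)"
  proof -
    have "(\<Oplus>k\<in>{..n}. T n (Suc k)) \<oplus> T n 0 = (\<Oplus>k\<in>{..Suc n}. T n k)"
      by (rule finsum_Suc2[symmetric]) (simp add: T)
    also have "\<dots> = T n (Suc n) \<oplus> (\<Oplus>k\<in>{..n}. T n k)" by (rule finsum_Suc) (simp add: T)
    finally show ?thesis by (simp add: T_zero T)
  qed
  have "(\<Oplus>k\<in>{..Suc n}. T (Suc n) k) = (\<Oplus>k\<in>{..n}. T (Suc n) (Suc k)) \<oplus> T (Suc n) 0"
    by (rule finsum_Suc2) (simp add: T)
  also have "(\<Oplus>k\<in>{..n}. T (Suc n) (Suc k)) = (\<Oplus>k\<in>{..n}. x \<otimes> T n k \<oplus> y \<otimes> T n (Suc k))"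
    by (rule finsum_cong') (auto simp: T x y step)
  also have "\<dots> = (\<Oplus>k\<in>{..n}. x \<otimes> T n k) \<oplus> (\<Oplus>k\<in>{..n}. y \<otimes> T n (Suc k))"
    by (rule finsum_addf) (auto simp: T x y)
  also have "\<dots> = x \<otimes> (\<Oplus>k\<in>{..n}. T n k) \<oplus> y \<otimes> (\<Oplus>k\<in>{..n}. T n (Suc k))"
    using finsum_rdistr[of "{..n}" x "T n"] finsum_rdistr[of "{..n}" y "\<lambda>k. T n (Suc k)"]
    by (simp add: T x y Pi_def)
  also have "\<dots> \<oplus> T (Suc n) 0
      = x \<otimes> (\<Oplus>k\<in>{..n}. T n k) \<oplus> y \<otimes> ((\<Oplus>k\<in>{..n}. T n (Suc k)) \<oplus> T n 0)"
    using x y by (simp add: step0 T r_distr a_assoc Pi_def)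
  also have "\<dots> = (x \<oplus> y) [^] Suc n"
    using x y by (simp add: tail IH[symmetric] l_distr m_comm T Pi_def del: finsum_closed)
  finally show ?case by (simp add: T_def)
qed

locale prime_char_cring = cring R for R (structure) +
  fixes p :: nat
  assumes prime_p: "Factorial_Ring.prime p" and char_p: "[p] \<cdot> \<one> = \<zero>"
begin

lemma p_gt_1: "p > 1"
  using prime_p prime_gt_1_nat by blast

lemma add_pow_char_dvd:
  assumes "x \<in> carrier R" "p dvd n"
  shows "[n] \<cdot> x = \<zero>"
proof -
  obtain m where m: "n = p * m" using assms(2) by blast
  have "[p] \<cdot> x = ([p] \<cdot> \<one>) \<otimes> x" using assms by (simp add: add_pow_ldistr)
  hence "[p] \<cdot> x = \<zero>" using assms by (simp add: char_p)
  thus ?thesis using assms add.nat_pow_pow[of x m p] by (simp add: m)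
qed

lemma frobenius_add:
  assumes x: "x \<in> carrier R" and y: "y \<in> carrier R"
  shows "(x \<oplus> y) [^] p = x [^] p \<oplus> y [^] p"
proof -
  define T where "T k = [(p choose k)] \<cdot> (x [^] k \<otimes> y [^] (p - k))" for k :: nat
  have T: "T k \<in> carrier R" for k using x y by (simp add: T_def)
  have T_zero: "T k = \<zero>" if "k \<notin> {0, p}" for k
  proof (cases "k < p")
    case True
    thus ?thesis unfolding T_def using that x y prime_p
      by (intro add_pow_char_dvd) (auto intro!: dvd_choose_prime)
  next
    case False
    thus ?thesis using that by (auto simp: T_def binomial_eq_0)
  qed
  have "(x \<oplus> y) [^] p = (\<Oplus>k\<in>{..p}. T k)" using binomial[OF x y] by (simp add: T_def)
  also have "\<dots> = (\<Oplus>k\<in>{0, p}. T k)"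
    by (rule add.finprod_mono_neutral_cong_right) (auto simp: T T_zero)
  also have "\<dots> = T 0 \<oplus> T p" using p_gt_1 T by simp
  finally show ?thesis using x y by (simp add: T_def a_comm)
qed

lemma frobenius_pow_add:
  assumes x: "x \<in> carrier R" and y: "y \<in> carrier R"
  shows "(x \<oplus> y) [^] (p ^ k) = x [^] (p ^ k) \<oplus> y [^] (p ^ k)"
proof (induction k)
  case (Suc k)
  have "(x \<oplus> y) [^] (p ^ Suc k) = ((x \<oplus> y) [^] (p ^ k)) [^] p"
    using x y by (simp add: nat_pow_pow mult.commute)
  also have "\<dots> = (x [^] (p ^ k)) [^] p \<oplus> (y [^] (p ^ k)) [^] p"
    using x y by (simp add: Suc frobenius_add)
  finally show ?case using x y by (simp add: nat_pow_pow mult.commute)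
qed (use x y in simp)

lemma frobenius_pow_a_inv:
  assumes x: "x \<in> carrier R"
  shows "(\<ominus> x) [^] (p ^ k) = \<ominus> (x [^] (p ^ k))"
proof -
  have "(x \<oplus> \<ominus> x) [^] (p ^ k) = x [^] (p ^ k) \<oplus> (\<ominus> x) [^] (p ^ k)"
    using x by (intro frobenius_pow_add) auto
  hence "x [^] (p ^ k) \<oplus> (\<ominus> x) [^] (p ^ k) = \<zero>"
    using x p_gt_1 by (simp add: r_neg nat_pow_zero)
  thus ?thesis using x by (metis add.inv_equality a_comm nat_pow_closed a_inv_closed)
qed

end

section \<open>Finite subfields of an algebraically closed field\<close>

lemma (in domain) nat_pow_eq_zero:
  assumes "x \<in> carrier R" "x [^] (n::nat) = \<zero>"
  shows "x = \<zero>"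
  using assms by (induction n) (auto dest: integral)

lemma (in prime_char_cring) prime_char_poly_ring:
  assumes "domain R"
  shows "prime_char_cring (poly_ring R) p"
proof -
  interpret domain R by fact
  interpret UP: domain "poly_ring R"
    using univ_poly_is_domain[OF carrier_is_subring] .
  interpret h: ring_hom_ring R "poly_ring R" poly_of_const
    using canonical_embedding_ring_hom[OF carrier_is_subring] by simp
  show ?thesis
  proof (unfold_locales)
    have "poly_of_const ([p] \<cdot> \<one>) = [p] \<cdot>\<^bsub>poly_ring R\<^esub> \<one>\<^bsub>poly_ring R\<^esub>"
      by (induction p) auto
    thus "[p] \<cdot>\<^bsub>poly_ring R\<^esub> \<one>\<^bsub>poly_ring R\<^esub> = \<zero>\<^bsub>poly_ring R\<^esub>"
      by (simp add: char_p)
  qed (rule prime_p)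
qed

locale prime_char_field = field R + prime_char_cring R p for R (structure) and p
begin

definition frob_fixed :: "nat \<Rightarrow> 'a set" where
  "frob_fixed k = {x \<in> carrier R. x [^] (p ^ k) = x}"

lemma frob_fixed_carrier: "frob_fixed k \<subseteq> carrier R"
  by (auto simp: frob_fixed_def)

lemma p_pow_pos: "p ^ k > 0"
  using p_gt_1 by simp

lemma frob_fixed_subring: "subring (frob_fixed k) R"
proof (rule subringI)
  fix x y assume "x \<in> frob_fixed k" "y \<in> frob_fixed k"
  thus "x \<otimes> y \<in> frob_fixed k" "x \<oplus> y \<in> frob_fixed k"
    by (auto simp: frob_fixed_def nat_pow_distrib frobenius_pow_add)
next
  fix x assume "x \<in> frob_fixed k"
  thus "\<ominus> x \<in> frob_fixed k" by (auto simp: frob_fixed_def frobenius_pow_a_inv)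
qed (auto simp: frob_fixed_def)

lemma frob_fixed_subfield: "subfield (frob_fixed k) R"
proof (rule subfieldI'[OF frob_fixed_subring])
  fix x assume x: "x \<in> frob_fixed k - {\<zero>}"
  hence u: "x \<in> Units R" and c: "x \<in> carrier R" and e: "x [^] (p ^ k) = x"
    by (auto simp: field_Units frob_fixed_def)
  have i: "inv x \<in> carrier R" using u by simp
  have "x \<otimes> (inv x) [^] (p ^ k) = (x \<otimes> inv x) [^] (p ^ k)"
    using c i by (simp add: nat_pow_distrib e)
  hence "x \<otimes> (inv x) [^] (p ^ k) = \<one>" using u by simp
  hence "(inv x) [^] (p ^ k) = inv x"
    using comm_inv_char[OF c, of "inv x [^] (p ^ k)"] i by simp
  thus "inv x \<in> frob_fixed k" using i by (simp add: frob_fixed_def)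
qed

lemma frobenius_pow_inj:
  assumes x: "x \<in> carrier R" and y: "y \<in> carrier R" and eq: "x [^] (p ^ k) = y [^] (p ^ k)"
  shows "x = y"
proof -
  have "(x \<oplus> \<ominus> y) [^] (p ^ k) = x [^] (p ^ k) \<oplus> \<ominus> (y [^] (p ^ k))"
    using x y by (simp add: frobenius_pow_add frobenius_pow_a_inv)
  also have "\<dots> = \<zero>" using x y by (simp add: eq r_neg)
  finally have "x \<oplus> \<ominus> y = \<zero>" using x y by (simp add: nat_pow_eq_zero[of _ "p ^ k"])
  hence "\<ominus> (\<ominus> y) = x" using x y by (intro minus_equality) auto
  thus ?thesis using y by simp
qed

lemma frob_fixed_add:
  assumes "x \<in> frob_fixed a"
  shows "x \<in> frob_fixed (a + b) \<longleftrightarrow> x \<in> frob_fixed b"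
proof -
  have c: "x \<in> carrier R" and e: "x [^] (p ^ a) = x" using assms by (auto simp: frob_fixed_def)
  have "x [^] (p ^ (a + b)) = (x [^] (p ^ a)) [^] (p ^ b)"
    using c by (simp add: nat_pow_pow power_add)
  thus ?thesis using c e by (simp add: frob_fixed_def)
qed

lemma frob_fixed_0: "frob_fixed 0 = carrier R"
  by (auto simp: frob_fixed_def)

lemma frob_fixed_mod:
  assumes "x \<in> frob_fixed a"
  shows "x \<in> frob_fixed b \<longleftrightarrow> x \<in> frob_fixed (b mod a)"
proof -
  have "x \<in> frob_fixed (a * m + r) \<longleftrightarrow> x \<in> frob_fixed r" for m r
    by (induction m) (use assms in \<open>simp_all add: frob_fixed_add add.assoc\<close>)
  from this[of "b div a" "b mod a"] show ?thesis by simp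
qed

lemma frob_fixed_gcd:
  assumes "x \<in> frob_fixed a" "x \<in> frob_fixed b"
  shows "x \<in> frob_fixed (gcd a b)"
  using assms
proof (induction a b rule: gcd_nat_induct)
  case (step m n)
  thus ?case using frob_fixed_mod[of x n m] by (simp add: gcd_red_nat[of m n])
qed auto

lemma frob_fixed_mono:
  assumes "a dvd b"
  shows "frob_fixed a \<subseteq> frob_fixed b"
proof
  fix x assume x: "x \<in> frob_fixed a"
  show "x \<in> frob_fixed b"
    using frob_fixed_mod[OF x, of b] assms x frob_fixed_0 frob_fixed_carrier by auto
qed

lemma card_subfield_imp_frob_fixed:
  assumes K: "subfield K R" and card: "card K = p ^ k"
  shows "K \<subseteq> frob_fixed k"
proof
  fix x assume x: "x \<in> K"
  have fin: "finite K" using card p_pow_pos[of k] by (metis card.infinite less_irrefl)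
  interpret K: field "R\<lparr>carrier := K\<rparr>" using subfield_iff(2)[OF K] .
  have sub: "K \<subseteq> carrier R" using subfieldE(3)[OF K] .
  interpret G: group "Multiplicative_Group.mult_of (R\<lparr>carrier := K\<rparr>)" by (rule K.field_mult_group)
  show "x \<in> frob_fixed k"
  proof (cases "x = \<zero>")
    case True
    thus ?thesis using p_pow_pos[of k] by (simp add: frob_fixed_def nat_pow_zero)
  next
    case False
    have ord: "order (Multiplicative_Group.mult_of (R\<lparr>carrier := K\<rparr>)) = p ^ k - 1"
      using fin card K.zero_closed by (simp add: order_def)
    have "x [^]\<^bsub>Multiplicative_Group.mult_of (R\<lparr>carrier := K\<rparr>)\<^esub> (p ^ k - 1) = \<one>"
      using G.pow_order_eq_1[of x] x False unfolding ord by simp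
    hence "x [^] (p ^ k - 1) = \<one>" by (simp add: Multiplicative_Group.nat_pow_mult_of nat_pow_consistent[symmetric])
    moreover have "x [^] (p ^ k) = x [^] (p ^ k - 1) \<otimes> x"
      using p_pow_pos[of k] nat_pow_Suc[of x "p ^ k - 1"] by simp
    ultimately show ?thesis using x sub by (auto simp: frob_fixed_def)
  qed
qed

end

locale prime_char_closed_field = prime_char_field R p + algebraically_closed R
  for R (structure) and p
begin

lemma card_frob_fixed:
  assumes "k > 0"
  shows "card (frob_fixed k) = p ^ k"
proof -
  define q where "q = p ^ k"
  have q: "q > 1" using assms p_gt_1 unfolding q_def by (metis one_less_power)
  interpret UP: domain "poly_ring R"
    using univ_poly_is_domain[OF carrier_is_subring] .
  interpret UP: prime_char_cring "poly_ring R" p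
    by (rule prime_char_poly_ring) unfold_locales
  interpret h: ring_hom_ring R "poly_ring R" poly_of_const
    using canonical_embedding_ring_hom[OF carrier_is_subring] by simp
  have X: "X \<in> carrier (poly_ring R)" by (rule var_closed[OF carrier_is_subring])
  define f where "f = X [^]\<^bsub>poly_ring R\<^esub> q \<oplus>\<^bsub>poly_ring R\<^esub> \<ominus>\<^bsub>poly_ring R\<^esub> X"
  have f: "f \<in> carrier (poly_ring R)" using X by (simp add: f_def)
  have minus_X: "\<ominus>\<^bsub>poly_ring R\<^esub> X = [\<ominus> \<one>, \<zero>]"
  proof (rule UP.minus_equality)
    show "[\<ominus> \<one>, \<zero>] \<in> carrier (poly_ring R)"
      by (simp add: univ_poly_def polynomial_def)
    show "[\<ominus> \<one>, \<zero>] \<oplus>\<^bsub>poly_ring R\<^esub> X = \<zero>\<^bsub>poly_ring R\<^esub>"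
      by (simp add: univ_poly_def var_def l_neg)
  qed (rule X)
  have deg: "degree f = q"
  proof -
    have 1: "X [^]\<^bsub>poly_ring R\<^esub> q = monom \<one> q"
      by (rule unitary_monom_eq_var_pow[OF carrier_is_subring, symmetric])
    have 2: "polynomial (carrier R) (monom \<one> q)"
      by (rule monom_is_polynomial[OF carrier_is_subring]) simp
    have 3: "polynomial (carrier R) [\<ominus> \<one>, \<zero>]" by (simp add: polynomial_def)
    from poly_add_degree_eq[OF carrier_is_subring 2 3] show ?thesis
      using q unfolding f_def 1 minus_X by (simp add: univ_poly_add monom_def)
  qed
  have root: "is_root f x \<longleftrightarrow> x \<in> frob_fixed k" for x
  proof (cases "x \<in> carrier R")
    case True
    interpret e: ring_hom_ring "poly_ring R" R "\<lambda>g. eval g x"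
      by (rule eval_ring_hom[OF carrier_is_subring True])
    have "eval f x = x [^] q \<oplus> \<ominus> x" using X True by (simp add: f_def e.hom_nat_pow eval_var)
    hence "eval f x = \<zero> \<longleftrightarrow> x [^] q = x"
      using True by (metis a_inv_closed minus_equality minus_minus nat_pow_closed r_neg)
    moreover have "f \<noteq> []" using deg q by auto
    ultimately show ?thesis using True by (simp add: is_root_def frob_fixed_def q_def)
  qed (auto simp: is_root_def frob_fixed_def)
  (* For a root a, X^q - X = (X - a)^q - (X - a), which is not divisible by (X - a)^2. *)
  have simple: "count (roots f) a \<le> 1" for a
  proof (rule ccontr)
    assume *: "\<not> count (roots f) a \<le> 1"
    hence "a \<in># roots f" by (simp flip: count_greater_zero_iff)
    hence "a \<in> frob_fixed k" using roots_mem_iff_is_root[OF f] root by simp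
    hence a: "a \<in> carrier R" and aq: "a [^] q = a" by (auto simp: frob_fixed_def q_def)
    define D where "D = [\<one>, \<ominus> a]"
    have D: "D \<in> carrier (poly_ring R)" using a by (simp add: D_def univ_poly_def polynomial_def)
    have c: "poly_of_const a \<in> carrier (poly_ring R)" using a by simp
    have XD: "X = D \<oplus>\<^bsub>poly_ring R\<^esub> poly_of_const a"
      using a by (simp add: D_def univ_poly_add var_def poly_of_const_def l_neg)
    have "(poly_of_const a) [^]\<^bsub>poly_ring R\<^esub> q = poly_of_const a"
      using h.hom_nat_pow[OF a, of q] aq by simp
    moreover have cancel: "(u \<oplus>\<^bsub>poly_ring R\<^esub> w) \<oplus>\<^bsub>poly_ring R\<^esub> (v \<oplus>\<^bsub>poly_ring R\<^esub> \<ominus>\<^bsub>poly_ring R\<^esub> w) = u \<oplus>\<^bsub>poly_ring R\<^esub> v"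
      if "u \<in> carrier (poly_ring R)" "v \<in> carrier (poly_ring R)" "w \<in> carrier (poly_ring R)" for u v w
    proof -
      have "(u \<oplus>\<^bsub>poly_ring R\<^esub> w) \<oplus>\<^bsub>poly_ring R\<^esub> (v \<oplus>\<^bsub>poly_ring R\<^esub> \<ominus>\<^bsub>poly_ring R\<^esub> w) = (u \<oplus>\<^bsub>poly_ring R\<^esub> v) \<oplus>\<^bsub>poly_ring R\<^esub> (w \<oplus>\<^bsub>poly_ring R\<^esub> \<ominus>\<^bsub>poly_ring R\<^esub> w)"
        using that by (simp add: UP.a_ac del: UP.r_neg)
      thus ?thesis using that by (simp add: UP.r_neg)
    qed
    ultimately have fD: "f = D [^]\<^bsub>poly_ring R\<^esub> q \<oplus>\<^bsub>poly_ring R\<^esub> \<ominus>\<^bsub>poly_ring R\<^esub> D"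
      using D c UP.frobenius_pow_add[OF D c, of k] unfolding f_def XD q_def
      by (simp add: UP.minus_add cancel)
    have "2 \<le> alg_mult f a" using * alg_mult_eq_count_roots[OF f] by simp
    hence "(D [^]\<^bsub>poly_ring R\<^esub> (2::nat)) pdivides f"
      using le_alg_mult_imp_pdivides[OF a f] by (simp add: D_def)
    then obtain g where g: "g \<in> carrier (poly_ring R)" "f = D [^]\<^bsub>poly_ring R\<^esub> (2::nat) \<otimes>\<^bsub>poly_ring R\<^esub> g"
      unfolding pdivides_def factor_def by auto
    obtain r where r: "q = Suc (Suc r)" using q by (metis One_nat_def Suc_lessE less_imp_Suc_add)
    have f1: "f = D \<otimes>\<^bsub>poly_ring R\<^esub> (D \<otimes>\<^bsub>poly_ring R\<^esub> g)"
      using g D by (simp add: numeral_2_eq_2 UP.m_assoc)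
    have f2: "f = D \<otimes>\<^bsub>poly_ring R\<^esub> (D \<otimes>\<^bsub>poly_ring R\<^esub> D [^]\<^bsub>poly_ring R\<^esub> r \<oplus>\<^bsub>poly_ring R\<^esub> \<ominus>\<^bsub>poly_ring R\<^esub> \<one>\<^bsub>poly_ring R\<^esub>)"
      using D by (simp add: fD r UP.r_distr UP.r_minus UP.m_ac)
    have "D \<noteq> \<zero>\<^bsub>poly_ring R\<^esub>" by (simp add: D_def univ_poly_zero)
    hence eq: "D \<otimes>\<^bsub>poly_ring R\<^esub> g = D \<otimes>\<^bsub>poly_ring R\<^esub> D [^]\<^bsub>poly_ring R\<^esub> r \<oplus>\<^bsub>poly_ring R\<^esub> \<ominus>\<^bsub>poly_ring R\<^esub> \<one>\<^bsub>poly_ring R\<^esub>"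
      using f1 f2 D g UP.m_lcancel[of D] by simp
    interpret e: ring_hom_ring "poly_ring R" R "\<lambda>g. eval g a"
      by (rule eval_ring_hom[OF carrier_is_subring a])
    have eD: "eval D a = \<zero>" using a by (simp add: D_def r_neg)
    have "\<zero> = \<ominus> \<one>"
      using arg_cong[OF eq, of "\<lambda>g. eval g a"] D g a eD by (simp add: e.hom_nat_pow)
    thus False by (metis minus_minus minus_zero one_closed one_not_zero)
  qed
  have "q = size (roots f)" using roots_over_carrier[OF f] deg by (simp add: splitted_def)
  also have "\<dots> = (\<Sum>a\<in>set_mset (roots f). count (roots f) a)" by (simp add: size_multiset_overloaded_eq)
  also have "\<dots> = (\<Sum>a\<in>set_mset (roots f). 1)"
    using simple by (intro sum.cong refl) (metis One_nat_def Suc_leI antisym count_greater_zero_iff)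
  also have "\<dots> = card (set_mset (roots f))" by simp
  also have "set_mset (roots f) = frob_fixed k"
    using roots_mem_iff_is_root[OF f] root by blast
  finally show ?thesis by (simp add: q_def)
qed

lemma finite_frob_fixed: "k > 0 \<Longrightarrow> finite (frob_fixed k)"
  using card_frob_fixed p_pow_pos by (metis card.infinite less_irrefl)

lemma subfield_card_unique:
  assumes "k > 0"
  shows "(THE K. subfield K R \<and> card K = p ^ k) = frob_fixed k"
proof (rule the_equality)
  fix K assume "subfield K R \<and> card K = p ^ k"
  thus "K = frob_fixed k"
    using card_subfield_imp_frob_fixed finite_frob_fixed[OF assms] card_frob_fixed[OF assms]
    by (metis card_subset_eq)
qed (use assms frob_fixed_subfield card_frob_fixed in auto)

end

section \<open>Bases of ring extensions\<close>

lemma (in abelian_monoid) finsum_cartesian_product: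
  assumes "finite I" "finite J" "\<And>i j. i \<in> I \<Longrightarrow> j \<in> J \<Longrightarrow> f (i, j) \<in> carrier G"
  shows "(\<Oplus>ij\<in>I \<times> J. f ij) = (\<Oplus>j\<in>J. \<Oplus>i\<in>I. f (i, j))"
  using assms(2,3)
proof (induction J rule: finite_induct)
  case (insert j J)
  have split: "I \<times> insert j J = (\<lambda>i. (i, j)) ` I \<union> I \<times> J" by auto
  have "(\<Oplus>ij\<in>I \<times> insert j J. f ij) = (\<Oplus>ij\<in>(\<lambda>i. (i, j)) ` I. f ij) \<oplus> (\<Oplus>ij\<in>I \<times> J. f ij)"
    unfolding split using assms(1) insert.hyps insert.prems
    by (intro finsum_Un_disjoint) auto
  also have "(\<Oplus>ij\<in>(\<lambda>i. (i, j)) ` I. f ij) = (\<Oplus>i\<in>I. f (i, j))"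
    using insert.prems by (intro finsum_reindex) (auto simp: inj_on_def)
  also have "(\<Oplus>ij\<in>I \<times> J. f ij) = (\<Oplus>j\<in>J. \<Oplus>i\<in>I. f (i, j))"
    using insert by auto
  finally show ?case using insert by (simp add: Pi_def)
qed simp

lemma (in abelian_monoid) finsum_swap:
  assumes "finite I" "finite J" "\<And>i j. i \<in> I \<Longrightarrow> j \<in> J \<Longrightarrow> f i j \<in> carrier G"
  shows "(\<Oplus>j\<in>J. \<Oplus>i\<in>I. f i j) = (\<Oplus>i\<in>I. \<Oplus>j\<in>J. f i j)"
proof -
  have "(\<Oplus>j\<in>J. \<Oplus>i\<in>I. f i j) = (\<Oplus>ij\<in>prod.swap ` (J \<times> I). f (fst ij) (snd ij))"
    using finsum_cartesian_product[of I J "\<lambda>ij. f (fst ij) (snd ij)"] assms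
    by (simp add: product_swap)
  also have "\<dots> = (\<Oplus>ji\<in>J \<times> I. f (fst (prod.swap ji)) (snd (prod.swap ji)))"
    using assms(3) by (intro finsum_reindex) auto
  also have "\<dots> = (\<Oplus>i\<in>I. \<Oplus>j\<in>J. f i j)"
    using finsum_cartesian_product[of J I "\<lambda>ji. f (snd ji) (fst ji)"] assms by simp
  finally show ?thesis .
qed

lemma (in abelian_monoid) finsum_mod_div:
  fixes f :: "nat \<Rightarrow> nat \<Rightarrow> 'a"
  assumes "\<And>i I. i < n \<Longrightarrow> I < m \<Longrightarrow> f i I \<in> carrier G"
  shows "(\<Oplus>r\<in>{..<n * m}. f (r mod n) (r div n)) = (\<Oplus>I\<in>{..<m}. \<Oplus>i\<in>{..<n}. f i I)"
proof -
  define h where "h = (\<lambda>(i, I). I * n + i)"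
  have lt: "I * n + i < n * m" if "i < n" "I < m" for i I
  proof -
    have "I * n + i < Suc I * n" using that by simp
    also have "\<dots> \<le> m * n" using that by (intro mult_right_mono) auto
    finally show ?thesis by (simp add: mult.commute)
  qed
  have h: "h x mod n = fst x" "h x div n = snd x" if "x \<in> {..<n} \<times> {..<m}" for x
    using that by (auto simp: h_def)
  have inj: "inj_on h ({..<n} \<times> {..<m})"
    by (rule inj_onI) (metis h prod_eqI)
  have img: "h ` ({..<n} \<times> {..<m}) = {..<n * m}"
  proof (intro equalityI subsetI)
    fix r assume r: "r \<in> {..<n * m}"
    hence "n > 0" by (cases n) auto
    hence "(r mod n, r div n) \<in> {..<n} \<times> {..<m}"
      using r by (simp add: less_mult_imp_div_less mult.commute)
    moreover have "h (r mod n, r div n) = r" by (simp add: h_def)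
    ultimately show "r \<in> h ` ({..<n} \<times> {..<m})" by (metis imageI)
  qed (auto simp: h_def lt)
  have "(\<Oplus>r\<in>{..<n * m}. f (r mod n) (r div n)) = (\<Oplus>x\<in>{..<n} \<times> {..<m}. f (h x mod n) (h x div n))"
    unfolding img[symmetric] using assms inj by (intro finsum_reindex) (auto simp: h)
  also have "\<dots> = (\<Oplus>x\<in>{..<n} \<times> {..<m}. f (fst x) (snd x))"
    using assms by (intro finsum_cong') (auto simp: h)
  also have "\<dots> = (\<Oplus>I\<in>{..<m}. \<Oplus>i\<in>{..<n}. f i I)"
    using finsum_cartesian_product[of "{..<n}" "{..<m}" "\<lambda>x. f (fst x) (snd x)"] assms by simp
  finally show ?thesis .
qed

lemma (in ring) finsum_a_inv:
  assumes "f \<in> I \<rightarrow> carrier R"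
  shows "(\<Oplus>i\<in>I. \<ominus> f i) = \<ominus> (\<Oplus>i\<in>I. f i)"
  using assms
proof (induction I rule: infinite_finite_induct)
  case (insert i I)
  thus ?case by (simp add: Pi_def minus_add)
qed auto

lemma (in ring) finsum_subring:
  assumes K: "subring K R" and f: "f \<in> I \<rightarrow> K"
  shows "finsum (R\<lparr>carrier := K\<rparr>) f I = finsum R f I" "finsum R f I \<in> K"
proof -
  interpret K: ring "R\<lparr>carrier := K\<rparr>" by (rule subring_is_ring[OF K])
  have "K \<subseteq> carrier R" using subringE(1)[OF K] .
  with f show 1: "finsum (R\<lparr>carrier := K\<rparr>) f I = finsum R f I"
  proof (induction I rule: infinite_finite_induct)
    case (insert i I)
    hence *: "f \<in> I \<rightarrow> K" "f i \<in> K" "f \<in> I \<rightarrow> carrier R" "f i \<in> carrier R" by auto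
    show ?case using insert.hyps insert.IH[OF *(1)] insert.prems * by simp
  qed (simp_all add: K.add.finprod_infinite)
  show "finsum R f I \<in> K" using K.finsum_closed[of f I] f unfolding 1 by simp
qed

definition (in ring) lin_indep :: "'a set \<Rightarrow> 'i set \<Rightarrow> ('i \<Rightarrow> 'a) \<Rightarrow> bool" where
  "lin_indep K I b \<longleftrightarrow>
     (\<forall>c \<in> I \<rightarrow> K. (\<Oplus>i\<in>I. c i \<otimes> b i) = \<zero> \<longrightarrow> (\<forall>i\<in>I. c i = \<zero>))"

lemma (in ring) lin_indepD:
  assumes "lin_indep K I b" "\<And>i. i \<in> I \<Longrightarrow> c i \<in> K" "(\<Oplus>i\<in>I. c i \<otimes> b i) = \<zero>" "i \<in> I"
  shows "c i = \<zero>"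
  using assms unfolding lin_indep_def by blast

lemma (in ring) lin_indep_reindex:
  assumes h: "bij_betw h A B" and b: "b \<in> B \<rightarrow> carrier R" and K: "K \<subseteq> carrier R"
    and indep: "lin_indep K A d" and d: "\<And>a. a \<in> A \<Longrightarrow> d a = b (h a)"
  shows "lin_indep K B b"
  unfolding lin_indep_def
proof (intro ballI impI)
  fix c i assume c: "c \<in> B \<rightarrow> K" and z: "(\<Oplus>i\<in>B. c i \<otimes> b i) = \<zero>" and i: "i \<in> B"
  have B: "B = h ` A" and inj: "inj_on h A" using h by (auto simp: bij_betw_def)
  have "(\<Oplus>i\<in>B. c i \<otimes> b i) = (\<Oplus>a\<in>A. c (h a) \<otimes> b (h a))"
    unfolding B using b c K inj by (intro finsum_reindex) (auto simp: B)
  also have "\<dots> = (\<Oplus>a\<in>A. c (h a) \<otimes> d a)"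
    using b c K by (intro finsum_cong') (auto simp: B d intro!: m_closed)
  finally have "(\<Oplus>a\<in>A. c (h a) \<otimes> d a) = \<zero>" using z by simp
  moreover obtain a where a: "a \<in> A" "i = h a" using i B by auto
  ultimately show "c i = \<zero>"
    using lin_indepD[OF indep, of "\<lambda>a. c (h a)" a] c by (auto simp: B)
qed

lemma (in cring) lin_indep_tower:
  assumes fin: "finite I" "finite J"
    and F: "subring F R" and K: "K \<subseteq> F"
    and b: "b \<in> I \<rightarrow> F" and d: "d \<in> J \<rightarrow> carrier R"
    and indep_b: "lin_indep K I b" and indep_d: "lin_indep F J d"
  shows "lin_indep K (I \<times> J) (\<lambda>(i, j). b i \<otimes> d j)"
  unfolding lin_indep_def
proof (intro ballI impI)
  fix c ij assume c: "c \<in> I \<times> J \<rightarrow> K" and z: "(\<Oplus>ij\<in>I \<times> J. c ij \<otimes> (case ij of (i, j) \<Rightarrow> b i \<otimes> d j)) = \<zero>"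
    and ij: "ij \<in> I \<times> J"
  have FR: "F \<subseteq> carrier R" using subringE(1)[OF F] .
  have cF: "c (i, j) \<in> F" if "i \<in> I" "j \<in> J" for i j using c K that by auto
  have cb: "(\<lambda>i. c (i, j) \<otimes> b i) \<in> I \<rightarrow> F" if "j \<in> J" for j
    using cF b that by (auto intro!: subringE(6)[OF F])
  have cbR: "c (i, j) \<otimes> b i \<in> carrier R" "c (i, j) \<in> carrier R" "b i \<in> carrier R" "d j \<in> carrier R"
    if "i \<in> I" "j \<in> J" for i j
    using cb[of j] cF[of i j] b d that FR by auto
  define u where "u j = (\<Oplus>i\<in>I. c (i, j) \<otimes> b i)" for j
  have u: "u j \<in> F" if "j \<in> J" for j
    unfolding u_def using finsum_subring(2)[OF F cb[OF that]] .
  have "(\<Oplus>ij\<in>I \<times> J. c ij \<otimes> (case ij of (i, j) \<Rightarrow> b i \<otimes> d j))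
      = (\<Oplus>j\<in>J. \<Oplus>i\<in>I. c (i, j) \<otimes> (b i \<otimes> d j))"
    using fin cbR by (subst finsum_cartesian_product) auto
  also have "\<dots> = (\<Oplus>j\<in>J. u j \<otimes> d j)"
  proof (rule finsum_cong')
    fix j assume j: "j \<in> J"
    have "(\<Oplus>i\<in>I. c (i, j) \<otimes> (b i \<otimes> d j)) = (\<Oplus>i\<in>I. c (i, j) \<otimes> b i \<otimes> d j)"
      using cbR j by (intro finsum_cong') (auto simp: m_assoc)
    also have "\<dots> = u j \<otimes> d j"
      unfolding u_def using fin cbR d j by (intro finsum_ldistr[symmetric]) auto
    finally show "(\<Oplus>i\<in>I. c (i, j) \<otimes> (b i \<otimes> d j)) = u j \<otimes> d j" .
  qed (use u d FR in auto)
  finally have "(\<Oplus>j\<in>J. u j \<otimes> d j) = \<zero>" using z by simp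
  hence zero: "u j = \<zero>" if "j \<in> J" for j
    using lin_indepD[OF indep_d, of u j] u that by blast
  obtain i j where ij': "ij = (i, j)" "i \<in> I" "j \<in> J" using ij by auto
  have "c (i, j) = \<zero>"
    using ij' c zero[of j] by (intro lin_indepD[OF indep_b, of "\<lambda>i. c (i, j)"]) (auto simp: u_def)
  thus "c ij = \<zero>" by (simp add: ij')
qed

lemma (in ring) lin_indep_imp_inj_on:
  assumes fin: "finite I" and K: "subring K R" and b: "b \<in> I \<rightarrow> carrier R"
    and indep: "lin_indep K I b" and nontriv: "\<one> \<noteq> \<zero>"
  shows "inj_on b I"
proof (rule inj_onI, rule ccontr)
  fix i j assume ij: "i \<in> I" "j \<in> I" "b i = b j" "i \<noteq> j"
  define c where "c k = (if k = i then \<one> else if k = j then \<ominus> \<one> else \<zero>)" for k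
  have bR: "b k \<in> carrier R" if "k \<in> I" for k using b that by auto
  have "(\<Oplus>k\<in>I. c k \<otimes> b k) = (\<Oplus>k\<in>{i, j}. c k \<otimes> b k)"
    using fin ij bR by (intro add.finprod_mono_neutral_cong_right) (auto simp: c_def)
  also have "\<dots> = \<zero>" using ij bR[of i] bR[of j] by (simp add: c_def l_minus r_neg)
  finally have "c i = \<zero>"
    using subringE(2,3,5)[OF K] ij by (intro lin_indepD[OF indep, of c]) (auto simp: c_def)
  thus False using nontriv by (simp add: c_def)
qed

definition (in ring) is_basis :: "'a set \<Rightarrow> 'a set \<Rightarrow> nat \<Rightarrow> (nat \<Rightarrow> 'a) \<Rightarrow> bool" where
  "is_basis K E n b \<longleftrightarrow> b \<in> {..<n} \<rightarrow> E \<and>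
     (\<forall>x\<in>E. \<exists>!c. c \<in> {..<n} \<rightarrow>\<^sub>E K \<and> x = (\<Oplus>i\<in>{..<n}. c i \<otimes> b i))"

lemma (in cring) lin_indep_imp_is_basis:
  assumes K: "subring K R" and E: "subring E R" and KE: "K \<subseteq> E"
    and fin: "finite E" and card: "card E = card K ^ n"
    and b: "b \<in> {..<n} \<rightarrow> E" and indep: "lin_indep K {..<n} b"
  shows "is_basis K E n b"
proof -
  define \<Phi> where "\<Phi> c = (\<Oplus>i\<in>{..<n}. c i \<otimes> b i)" for c
  have KR: "K \<subseteq> carrier R" and ER: "E \<subseteq> carrier R" using subringE(1) K E by auto
  have bR: "b i \<in> carrier R" if "i < n" for i using b ER that by auto
  have \<Phi>E: "\<Phi> c \<in> E" if "c \<in> {..<n} \<rightarrow>\<^sub>E K" for c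
    unfolding \<Phi>_def using that b KE by (intro finsum_subring(2)[OF E]) (auto intro!: subringE(6)[OF E])
  have inj: "inj_on \<Phi> ({..<n} \<rightarrow>\<^sub>E K)"
  proof (rule inj_onI)
    fix c c' assume c: "c \<in> {..<n} \<rightarrow>\<^sub>E K" and c': "c' \<in> {..<n} \<rightarrow>\<^sub>E K" and eq: "\<Phi> c = \<Phi> c'"
    have cR: "c i \<in> carrier R" "c' i \<in> carrier R" if "i < n" for i using c c' KR that by auto
    have "(\<Oplus>i\<in>{..<n}. (c i \<oplus> \<ominus> c' i) \<otimes> b i) = (\<Oplus>i\<in>{..<n}. c i \<otimes> b i \<oplus> \<ominus> (c' i \<otimes> b i))"
      using cR bR by (intro finsum_cong') (auto simp: l_distr l_minus)
    also have "\<dots> = \<Phi> c \<oplus> \<ominus> \<Phi> c'"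
      unfolding \<Phi>_def using cR bR
      by (subst finsum_addf) (auto simp: finsum_a_inv Pi_def)
    also have "\<dots> = \<zero>" using \<Phi>E[OF c'] ER by (auto simp: eq r_neg)
    finally have z: "(\<Oplus>i\<in>{..<n}. (c i \<oplus> \<ominus> c' i) \<otimes> b i) = \<zero>" .
    have "c i = c' i" if "i < n" for i
    proof -
      have "c i \<oplus> \<ominus> c' i = \<zero>"
        using c c' that
        by (intro lin_indepD[OF indep _ z])
          (auto simp: PiE_def Pi_def intro!: subringE(7)[OF K] subringE(5)[OF K])
      hence "\<ominus> (\<ominus> c' i) = c i" using cR[OF that] by (intro minus_equality) auto
      thus ?thesis using cR[OF that] by simp
    qed
    thus "c = c'" using c c' by (intro PiE_ext) auto
  qed
  have "\<Phi> ` ({..<n} \<rightarrow>\<^sub>E K) = E"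
  proof (rule card_subset_eq[OF fin])
    show "\<Phi> ` ({..<n} \<rightarrow>\<^sub>E K) \<subseteq> E" using \<Phi>E by auto
    show "card (\<Phi> ` ({..<n} \<rightarrow>\<^sub>E K)) = card E"
      unfolding card_image[OF inj] by (simp add: card_PiE card)
  qed
  hence "\<exists>!c. c \<in> {..<n} \<rightarrow>\<^sub>E K \<and> x = \<Phi> c" if "x \<in> E" for x
    using inj that unfolding inj_on_def by blast
  thus ?thesis using b by (simp add: is_basis_def \<Phi>_def)
qed

section \<open>Regular representations\<close>

definition (in ring) coords :: "'a set \<Rightarrow> nat \<Rightarrow> (nat \<Rightarrow> 'a) \<Rightarrow> 'a \<Rightarrow> nat \<Rightarrow> 'a" where
  "coords K n b x = (THE c. c \<in> {..<n} \<rightarrow>\<^sub>E K \<and> x = (\<Oplus>i\<in>{..<n}. c i \<otimes> b i))"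

definition (in ring) regular_rep :: "'a set \<Rightarrow> nat \<Rightarrow> (nat \<Rightarrow> 'a) \<Rightarrow> 'a \<Rightarrow> 'a mat" where
  "regular_rep K n b x = mat n n (\<lambda>(i, j). coords K n b (x \<otimes> b j) i)"

lemma (in ring) regular_rep_carrier [simp]: "regular_rep K n b x \<in> carrier_mat n n"
  by (simp add: regular_rep_def)

lemma (in ring) is_basis_mem:
  "is_basis K E n b \<Longrightarrow> i < n \<Longrightarrow> b i \<in> E"
  by (auto simp: is_basis_def)

lemma (in ring) coords:
  assumes "is_basis K E n b" "x \<in> E"
  shows "i < n \<Longrightarrow> coords K n b x i \<in> K"
    and "x = (\<Oplus>i\<in>{..<n}. coords K n b x i \<otimes> b i)"
proof -
  have "\<exists>!c. c \<in> {..<n} \<rightarrow>\<^sub>E K \<and> x = (\<Oplus>i\<in>{..<n}. c i \<otimes> b i)"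
    using assms by (simp add: is_basis_def)
  from theI'[OF this] show "i < n \<Longrightarrow> coords K n b x i \<in> K"
    and "x = (\<Oplus>i\<in>{..<n}. coords K n b x i \<otimes> b i)"
    unfolding coords_def by auto
qed

lemma (in ring) coords_unique:
  assumes basis: "is_basis K E n b" and K: "K \<subseteq> carrier R" and E: "E \<subseteq> carrier R" and x: "x \<in> E"
    and c: "\<And>i. i < n \<Longrightarrow> c i \<in> K" and eq: "x = (\<Oplus>i\<in>{..<n}. c i \<otimes> b i)" and i: "i < n"
  shows "coords K n b x i = c i"
proof -
  have "(\<Oplus>i\<in>{..<n}. c i \<otimes> b i) = (\<Oplus>i\<in>{..<n}. restrict c {..<n} i \<otimes> b i)"
    using c K E is_basis_mem[OF basis] by (intro finsum_cong') (auto intro!: m_closed)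
  hence "coords K n b x = restrict c {..<n}"
    unfolding coords_def using basis x c eq
    by (intro the1_equality) (auto simp: is_basis_def)
  thus ?thesis using i by simp
qed

locale subring_basis = cring R for R (structure) +
  fixes K E :: "'a set" and n :: nat and b :: "nat \<Rightarrow> 'a"
  assumes K_subring: "subring K R" and E_subring: "subring E R" and K_subset: "K \<subseteq> E"
    and basis: "is_basis K E n b"
begin

lemma E_carrier: "x \<in> E \<Longrightarrow> x \<in> carrier R"
  using subringE(1)[OF E_subring] by auto

lemma K_carrier: "x \<in> K \<Longrightarrow> x \<in> carrier R"
  using subringE(1)[OF K_subring] by auto

lemma b_mem: "i < n \<Longrightarrow> b i \<in> E"
  by (rule is_basis_mem[OF basis])

lemma b_carrier: "i < n \<Longrightarrow> b i \<in> carrier R"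
  by (simp add: b_mem E_carrier)

lemma mult_b_mem: "x \<in> E \<Longrightarrow> j < n \<Longrightarrow> x \<otimes> b j \<in> E"
  by (intro subringE(6)[OF E_subring] b_mem)

lemma regular_rep_entry:
  assumes "x \<in> E" "i < n" "j < n"
  shows "regular_rep K n b x $$ (i, j) \<in> K"
  using coords(1)[OF basis mult_b_mem] assms by (simp add: regular_rep_def)

lemma regular_rep_entry_carrier:
  assumes "x \<in> E" "i < n" "j < n"
  shows "regular_rep K n b x $$ (i, j) \<in> carrier R"
  using assms by (simp add: regular_rep_entry K_carrier)

lemma mult_b_expand:
  assumes "x \<in> E" "j < n"
  shows "x \<otimes> b j = (\<Oplus>i\<in>{..<n}. regular_rep K n b x $$ (i, j) \<otimes> b i)"
proof -
  have "x \<otimes> b j = (\<Oplus>i\<in>{..<n}. coords K n b (x \<otimes> b j) i \<otimes> b i)"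
    by (rule coords(2)[OF basis mult_b_mem[OF assms]])
  also have "\<dots> = (\<Oplus>i\<in>{..<n}. regular_rep K n b x $$ (i, j) \<otimes> b i)"
    using assms by (intro finsum_cong')
      (auto simp: regular_rep_def b_carrier K_carrier coords(1)[OF basis mult_b_mem])
  finally show ?thesis .
qed

lemma regular_rep_eqI:
  assumes x: "x \<in> E" and A: "A \<in> carrier_mat n n"
    and mem: "\<And>i j. i < n \<Longrightarrow> j < n \<Longrightarrow> A $$ (i, j) \<in> K"
    and eq: "\<And>j. j < n \<Longrightarrow> x \<otimes> b j = (\<Oplus>i\<in>{..<n}. A $$ (i, j) \<otimes> b i)"
  shows "regular_rep K n b x = A"
proof (rule eq_matI)
  fix i j assume "i < dim_row A" "j < dim_col A"
  hence ij: "i < n" "j < n" using A by auto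
  show "regular_rep K n b x $$ (i, j) = A $$ (i, j)"
    using coords_unique[OF basis _ _ mult_b_mem[OF x ij(2)], of "\<lambda>i. A $$ (i, j)" i]
      ij mem eq[OF ij(2)] K_carrier E_carrier
    by (auto simp: regular_rep_def)
qed (use A in \<open>auto simp: regular_rep_def\<close>)

lemma regular_rep_one:
  "regular_rep K n b \<one> = mat n n (\<lambda>(i, j). if i = j then \<one> else \<zero>)"
proof (rule regular_rep_eqI)
  fix j assume j: "j < n"
  have "(\<Oplus>i\<in>{..<n}. mat n n (\<lambda>(i, j). if i = j then \<one> else \<zero>) $$ (i, j) \<otimes> b i)
      = (\<Oplus>i\<in>{..<n}. if j = i then b i else \<zero>)"
    using j by (intro finsum_cong') (auto simp: b_carrier)
  also have "\<dots> = b j"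
    using j by (intro add.finprod_singleton) (auto simp: b_carrier)
  finally show "\<one> \<otimes> b j = (\<Oplus>i\<in>{..<n}. mat n n (\<lambda>(i, j). if i = j then \<one> else \<zero>) $$ (i, j) \<otimes> b i)"
    using j by (simp add: b_carrier)
qed (use subringE(2,3)[OF K_subring] subringE(3)[OF E_subring] in auto)

lemma regular_rep_add:
  assumes x: "x \<in> E" and y: "y \<in> E"
  shows "regular_rep K n b (x \<oplus> y) =
    mat n n (\<lambda>(i, j). regular_rep K n b x $$ (i, j) \<oplus> regular_rep K n b y $$ (i, j))"
proof (rule regular_rep_eqI)
  fix j assume j: "j < n"
  have "(x \<oplus> y) \<otimes> b j = x \<otimes> b j \<oplus> y \<otimes> b j"
    using x y j by (simp add: l_distr E_carrier b_carrier)
  also have "\<dots> = (\<Oplus>i\<in>{..<n}. regular_rep K n b x $$ (i, j) \<otimes> b i \<oplus> regular_rep K n b y $$ (i, j) \<otimes> b i)"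
    unfolding mult_b_expand[OF x j] mult_b_expand[OF y j]
    using x y j by (intro finsum_addf[symmetric]) (auto simp: regular_rep_entry_carrier b_carrier)
  also have "\<dots> = (\<Oplus>i\<in>{..<n}. mat n n (\<lambda>(i, j). regular_rep K n b x $$ (i, j) \<oplus> regular_rep K n b y $$ (i, j)) $$ (i, j) \<otimes> b i)"
    using x y j by (intro finsum_cong') (auto simp: regular_rep_entry_carrier b_carrier l_distr)
  finally show "(x \<oplus> y) \<otimes> b j = \<dots>" .
qed (use x y in \<open>auto simp: regular_rep_entry intro!: subringE(7)[OF E_subring] subringE(7)[OF K_subring]\<close>)

lemma regular_rep_smult:
  assumes c: "c \<in> K" and x: "x \<in> E"
  shows "regular_rep K n b (c \<otimes> x) = mat n n (\<lambda>(i, j). c \<otimes> regular_rep K n b x $$ (i, j))"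
proof (rule regular_rep_eqI)
  fix j assume j: "j < n"
  have "(c \<otimes> x) \<otimes> b j = c \<otimes> (x \<otimes> b j)"
    using c x j by (simp add: m_assoc E_carrier K_carrier b_carrier)
  also have "\<dots> = (\<Oplus>i\<in>{..<n}. c \<otimes> (regular_rep K n b x $$ (i, j) \<otimes> b i))"
    unfolding mult_b_expand[OF x j]
    using c x j by (intro finsum_rdistr) (auto simp: regular_rep_entry_carrier b_carrier K_carrier)
  also have "\<dots> = (\<Oplus>i\<in>{..<n}. mat n n (\<lambda>(i, j). c \<otimes> regular_rep K n b x $$ (i, j)) $$ (i, j) \<otimes> b i)"
    using c x j by (intro finsum_cong') (auto simp: regular_rep_entry_carrier b_carrier K_carrier m_assoc)
  finally show "(c \<otimes> x) \<otimes> b j = \<dots>" .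
qed (use c x K_subset in \<open>auto simp: regular_rep_entry intro!: subringE(6)[OF E_subring] subringE(6)[OF K_subring]\<close>)

lemma regular_rep_mult:
  assumes x: "x \<in> E" and y: "y \<in> E"
  shows "regular_rep K n b (x \<otimes> y) =
    mat n n (\<lambda>(i, j). \<Oplus>k\<in>{..<n}. regular_rep K n b x $$ (i, k) \<otimes> regular_rep K n b y $$ (k, j))"
    (is "_ = ?M")
proof (rule regular_rep_eqI)
  let ?X = "\<lambda>i j. regular_rep K n b x $$ (i, j)"
  let ?Y = "\<lambda>i j. regular_rep K n b y $$ (i, j)"
  have XY: "?X i j \<in> carrier R" "?Y i j \<in> carrier R" if "i < n" "j < n" for i j
    using x y that by (auto simp: regular_rep_entry_carrier)
  fix j assume j: "j < n"
  have "(x \<otimes> y) \<otimes> b j = x \<otimes> (y \<otimes> b j)"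
    using x y j by (simp add: m_assoc E_carrier b_carrier)
  also have "\<dots> = (\<Oplus>k\<in>{..<n}. x \<otimes> (?Y k j \<otimes> b k))"
    unfolding mult_b_expand[OF y j] using x j XY
    by (intro finsum_rdistr) (auto simp: b_carrier E_carrier)
  also have "\<dots> = (\<Oplus>k\<in>{..<n}. \<Oplus>i\<in>{..<n}. ?X i k \<otimes> ?Y k j \<otimes> b i)"
  proof (rule finsum_cong')
    fix k assume "k \<in> {..<n}"
    hence k: "k < n" by simp
    have "x \<otimes> (?Y k j \<otimes> b k) = ?Y k j \<otimes> (x \<otimes> b k)"
      using x j k XY by (simp add: m_lcomm b_carrier E_carrier)
    also have "\<dots> = (\<Oplus>i\<in>{..<n}. ?Y k j \<otimes> (?X i k \<otimes> b i))"
      unfolding mult_b_expand[OF x k] using j k XY by (intro finsum_rdistr) (auto simp: b_carrier)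
    also have "\<dots> = (\<Oplus>i\<in>{..<n}. ?X i k \<otimes> ?Y k j \<otimes> b i)"
      using j k XY by (intro finsum_cong') (auto simp: b_carrier m_ac)
    finally show "x \<otimes> (?Y k j \<otimes> b k) = \<dots>" .
  qed (use j XY b_carrier in auto)
  also have "\<dots> = (\<Oplus>i\<in>{..<n}. \<Oplus>k\<in>{..<n}. ?X i k \<otimes> ?Y k j \<otimes> b i)"
    using j XY b_carrier by (intro finsum_swap) auto
  also have "\<dots> = (\<Oplus>i\<in>{..<n}. ?M $$ (i, j) \<otimes> b i)"
  proof (rule finsum_cong')
    fix i assume "i \<in> {..<n}"
    hence i: "i < n" by simp
    have "(\<Oplus>k\<in>{..<n}. ?X i k \<otimes> ?Y k j \<otimes> b i) = (\<Oplus>k\<in>{..<n}. ?X i k \<otimes> ?Y k j) \<otimes> b i"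
      using i j XY by (intro finsum_ldistr[symmetric]) (auto simp: b_carrier)
    thus "(\<Oplus>k\<in>{..<n}. ?X i k \<otimes> ?Y k j \<otimes> b i) = ?M $$ (i, j) \<otimes> b i"
      using i j by simp
  qed (use j XY b_carrier in auto)
  finally show "(x \<otimes> y) \<otimes> b j = \<dots>" .
next
  fix i j assume ij: "i < n" "j < n"
  have "(\<Oplus>k\<in>{..<n}. regular_rep K n b x $$ (i, k) \<otimes> regular_rep K n b y $$ (k, j)) \<in> K"
    using ij x y by (intro finsum_subring(2)[OF K_subring])
      (auto simp: regular_rep_entry intro!: subringE(6)[OF K_subring])
  thus "?M $$ (i, j) \<in> K" using ij by simp
qed (use x y in \<open>auto intro!: subringE(6)[OF E_subring]\<close>)

lemma regular_rep_algebra_hom: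
  "regular_rep K n b \<in>
     algebra_hom (R\<lparr>carrier := K\<rparr>) (field_algebra (R\<lparr>carrier := E\<rparr>)) (mat_algebra (R\<lparr>carrier := K\<rparr>) n)"
proof -
  have fs: "finsum (R\<lparr>carrier := K\<rparr>) (\<lambda>k. regular_rep K n b x $$ (i, k) \<otimes> regular_rep K n b y $$ (k, j)) {..<n}
      = (\<Oplus>k\<in>{..<n}. regular_rep K n b x $$ (i, k) \<otimes> regular_rep K n b y $$ (k, j))"
    if "x \<in> E" "y \<in> E" "i < n" "j < n" for x y i j
    using that by (intro finsum_subring(1)[OF K_subring])
      (auto simp: regular_rep_entry intro!: subringE(6)[OF K_subring])
  show ?thesis
    unfolding algebra_hom_def
    by (auto intro!: ring_hom_memI cong_mat simp: field_algebra_def mat_algebra_def regular_rep_entry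
        regular_rep_mult regular_rep_add regular_rep_one regular_rep_smult fs)
qed

lemma regular_rep_inj: "inj_on (regular_rep K n b) E"
proof (rule inj_onI)
  fix x y assume x: "x \<in> E" and y: "y \<in> E" and eq: "regular_rep K n b x = regular_rep K n b y"
  have xy: "x \<otimes> b j = y \<otimes> b j" if "j < n" for j
    using mult_b_expand[OF x that] mult_b_expand[OF y that] eq by simp
  define c where "c = coords K n b \<one>"
  have one: "\<one> \<in> E" by (rule subringE(3)[OF E_subring])
  have c: "c j \<in> carrier R" if "j < n" for j
    using coords(1)[OF basis one that] K_carrier by (simp add: c_def)
  have expand: "z = (\<Oplus>j\<in>{..<n}. c j \<otimes> (z \<otimes> b j))" if z: "z \<in> E" for z
  proof -
    have "z = z \<otimes> (\<Oplus>j\<in>{..<n}. c j \<otimes> b j)"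
      using coords(2)[OF basis one] E_carrier[OF z] by (simp add: c_def)
    also have "\<dots> = (\<Oplus>j\<in>{..<n}. z \<otimes> (c j \<otimes> b j))"
      using E_carrier[OF z] c by (intro finsum_rdistr) (auto simp: b_carrier)
    also have "\<dots> = (\<Oplus>j\<in>{..<n}. c j \<otimes> (z \<otimes> b j))"
      using E_carrier[OF z] c by (intro finsum_cong') (auto simp: b_carrier m_lcomm)
    finally show ?thesis .
  qed
  have "(\<Oplus>j\<in>{..<n}. c j \<otimes> (x \<otimes> b j)) = (\<Oplus>j\<in>{..<n}. c j \<otimes> (y \<otimes> b j))"
    using c y E_carrier b_carrier by (intro finsum_cong') (auto simp: xy)
  thus "x = y" using expand[OF x] expand[OF y] by simp
qed

end

lemma (in ring) finsum_delta:
  assumes "finite A" "a \<in> A" "\<And>k. k \<in> A \<Longrightarrow> f k \<in> carrier R" "\<And>k. k \<in> A \<Longrightarrow> P k \<longleftrightarrow> k = a"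
  shows "(\<Oplus>k\<in>A. (if P k then \<one> else \<zero>) \<otimes> f k) = f a"
    and "(\<Oplus>k\<in>A. f k \<otimes> (if P k then \<one> else \<zero>)) = f a"
proof -
  have *: "(\<Oplus>k\<in>A. if a = k then f k else \<zero>) = f a"
    using assms by (intro add.finprod_singleton) auto
  have "(\<Oplus>k\<in>A. (if P k then \<one> else \<zero>) \<otimes> f k) = (\<Oplus>k\<in>A. if a = k then f k else \<zero>)"
    using assms by (intro finsum_cong') auto
  thus "(\<Oplus>k\<in>A. (if P k then \<one> else \<zero>) \<otimes> f k) = f a" using * by simp
  have "(\<Oplus>k\<in>A. f k \<otimes> (if P k then \<one> else \<zero>)) = (\<Oplus>k\<in>A. if a = k then f k else \<zero>)"
    using assms by (intro finsum_cong') auto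
  thus "(\<Oplus>k\<in>A. f k \<otimes> (if P k then \<one> else \<zero>)) = f a" using * by simp
qed

lemma (in ring) permutation_matrix_conj:
  fixes \<sigma> :: "nat \<Rightarrow> nat"
  assumes \<sigma>: "\<sigma> permutes {..<N}" and M: "M \<in> carrier (mat_algebra R N)"
  defines "Q \<equiv> mat N N (\<lambda>(i, j). if i = inv_into UNIV \<sigma> j then \<one> else \<zero>)"
  shows "Q \<otimes>\<^bsub>mat_algebra R N\<^esub> M \<otimes>\<^bsub>mat_algebra R N\<^esub> transpose_mat Q
    = mat N N (\<lambda>(i, j). M $$ (\<sigma> i, \<sigma> j))"
proof -
  have Mc: "M $$ (i, j) \<in> carrier R" if "i < N" "j < N" for i j
    using M that by (auto simp: mat_algebra_def)
  have \<sigma>N: "\<sigma> i < N" if "i < N" for i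
    using permutes_in_image[OF \<sigma>, of i] that by simp
  have inv_iff: "i = inv_into UNIV \<sigma> j \<longleftrightarrow> j = \<sigma> i" for i j
    using permutes_inverses[OF \<sigma>] by metis
  have QM: "Q \<otimes>\<^bsub>mat_algebra R N\<^esub> M = mat N N (\<lambda>(i, j). M $$ (\<sigma> i, j))"
  proof (rule eq_matI)
    fix i j assume "i < dim_row (mat N N (\<lambda>(i, j). M $$ (\<sigma> i, j)))"
      "j < dim_col (mat N N (\<lambda>(i, j). M $$ (\<sigma> i, j)))"
    hence ij: "i < N" "j < N" by auto
    have "(Q \<otimes>\<^bsub>mat_algebra R N\<^esub> M) $$ (i, j) = (\<Oplus>k\<in>{..<N}. Q $$ (i, k) \<otimes> M $$ (k, j))"
      using ij by (simp add: mat_algebra_def)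
    also have "\<dots> = (\<Oplus>k\<in>{..<N}. (if i = inv_into UNIV \<sigma> k then \<one> else \<zero>) \<otimes> M $$ (k, j))"
      using ij Mc by (intro finsum_cong') (auto simp: Q_def)
    also have "\<dots> = M $$ (\<sigma> i, j)"
      using ij Mc \<sigma>N by (intro finsum_delta(1)) (auto simp: inv_iff)
    finally show "(Q \<otimes>\<^bsub>mat_algebra R N\<^esub> M) $$ (i, j) = mat N N (\<lambda>(i, j). M $$ (\<sigma> i, j)) $$ (i, j)"
      using ij by simp
  qed (auto simp: mat_algebra_def)
  show ?thesis
  proof (rule eq_matI)
    fix i j assume "i < dim_row (mat N N (\<lambda>(i, j). M $$ (\<sigma> i, \<sigma> j)))"
      "j < dim_col (mat N N (\<lambda>(i, j). M $$ (\<sigma> i, \<sigma> j)))"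
    hence ij: "i < N" "j < N" by auto
    have "(Q \<otimes>\<^bsub>mat_algebra R N\<^esub> M \<otimes>\<^bsub>mat_algebra R N\<^esub> transpose_mat Q) $$ (i, j)
        = (\<Oplus>k\<in>{..<N}. mat N N (\<lambda>(i, j). M $$ (\<sigma> i, j)) $$ (i, k) \<otimes> transpose_mat Q $$ (k, j))"
      unfolding QM using ij by (simp add: mat_algebra_def)
    also have "\<dots> = (\<Oplus>k\<in>{..<N}. M $$ (\<sigma> i, k) \<otimes> (if j = inv_into UNIV \<sigma> k then \<one> else \<zero>))"
      using ij Mc \<sigma>N by (intro finsum_cong') (auto simp: Q_def)
    also have "\<dots> = M $$ (\<sigma> i, \<sigma> j)"
      using ij Mc \<sigma>N by (intro finsum_delta(2)) (auto simp: inv_iff)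
    finally show "(Q \<otimes>\<^bsub>mat_algebra R N\<^esub> M \<otimes>\<^bsub>mat_algebra R N\<^esub> transpose_mat Q) $$ (i, j)
        = mat N N (\<lambda>(i, j). M $$ (\<sigma> i, \<sigma> j)) $$ (i, j)"
      using ij by simp
  qed (auto simp: mat_algebra_def)
qed

lemma (in cring) regular_rep_tower:
  fixes \<sigma> :: "nat \<Rightarrow> nat"
  assumes "subring_basis R K F n b" and "subring_basis R F E m d" and "subring_basis R K E (n * m) e"
    and \<sigma>: "\<sigma> permutes {..<n * m}"
    and e: "\<And>r. r < n * m \<Longrightarrow> e (\<sigma> r) = b (r mod n) \<otimes> d (r div n)"
    and x: "x \<in> E"
  shows "flatten_blocks m n (map_mat (regular_rep K n b) (regular_rep F m d x))
    = mat (n * m) (n * m) (\<lambda>(i, j). regular_rep K (n * m) e x $$ (\<sigma> i, \<sigma> j))"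
proof -
  interpret KF: subring_basis R K F n b by fact
  interpret FE: subring_basis R F E m d by fact
  interpret KE: subring_basis R K E "n * m" e by fact
  define u where "u I J = regular_rep F m d x $$ (I, J)" for I J
  define M where "M r c = regular_rep K n b (u (r div n) (c div n)) $$ (r mod n, c mod n)" for r c
  have u: "u I J \<in> F" if "I < m" "J < m" for I J
    using that x FE.regular_rep_entry by (simp add: u_def)
  have dm: "r mod n < n" "r div n < m" if "r < n * m" for r
    using that by (cases "n = 0"; simp add: less_mult_imp_div_less mult.commute)+
  have M: "M r c \<in> K" if "r < n * m" "c < n * m" for r c
    using that u dm by (simp add: M_def KF.regular_rep_entry)
  have Mc: "M r c \<in> carrier R" if "r < n * m" "c < n * m" for r c
    using M[OF that] KF.K_carrier by simp
  have flat: "flatten_blocks m n (map_mat (regular_rep K n b) (regular_rep F m d x))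
      = mat (n * m) (n * m) (\<lambda>(r, c). M r c)"
    unfolding flatten_blocks_def
    by (intro cong_mat) (auto simp: M_def u_def dm regular_rep_def)
  have expand: "x \<otimes> e (\<sigma> c) = (\<Oplus>r\<in>{..<n * m}. M r c \<otimes> e (\<sigma> r))" if c: "c < n * m" for c
  proof -
    let ?j = "c mod n" and ?J = "c div n"
    have uc: "u I ?J \<in> carrier R" if "I < m" for I
      using u[of I ?J] that dm[OF c] KF.E_carrier by simp
    have rep: "regular_rep K n b (u I ?J) $$ (i, ?j) \<in> carrier R" if "I < m" "i < n" for i I
      using that u dm[OF c] by (simp add: KF.regular_rep_entry_carrier)
    have "(\<Oplus>r\<in>{..<n * m}. M r c \<otimes> e (\<sigma> r))
        = (\<Oplus>r\<in>{..<n * m}. regular_rep K n b (u (r div n) ?J) $$ (r mod n, ?j) \<otimes> (b (r mod n) \<otimes> d (r div n)))"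
      using rep dm by (intro finsum_cong') (auto simp: M_def e KF.b_carrier FE.b_carrier)
    also have "\<dots> = (\<Oplus>I\<in>{..<m}. \<Oplus>i\<in>{..<n}. regular_rep K n b (u I ?J) $$ (i, ?j) \<otimes> (b i \<otimes> d I))"
      using rep by (intro finsum_mod_div) (auto simp: KF.b_carrier FE.b_carrier)
    also have "\<dots> = (\<Oplus>I\<in>{..<m}. b ?j \<otimes> (u I ?J \<otimes> d I))"
    proof (rule finsum_cong')
      fix I assume "I \<in> {..<m}"
      hence I: "I < m" by simp
      have "(\<Oplus>i\<in>{..<n}. regular_rep K n b (u I ?J) $$ (i, ?j) \<otimes> (b i \<otimes> d I))
          = (\<Oplus>i\<in>{..<n}. regular_rep K n b (u I ?J) $$ (i, ?j) \<otimes> b i \<otimes> d I)"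
        using I rep by (intro finsum_cong') (auto simp: KF.b_carrier FE.b_carrier m_assoc)
      also have "\<dots> = (\<Oplus>i\<in>{..<n}. regular_rep K n b (u I ?J) $$ (i, ?j) \<otimes> b i) \<otimes> d I"
        using I rep by (intro finsum_ldistr[symmetric]) (auto simp: KF.b_carrier FE.b_carrier)
      also have "\<dots> = u I ?J \<otimes> b ?j \<otimes> d I"
        using KF.mult_b_expand[of "u I ?J" ?j] u I dm[OF c] by simp
      also have "\<dots> = b ?j \<otimes> (u I ?J \<otimes> d I)"
        using I uc dm[OF c] by (simp add: KF.b_carrier FE.b_carrier m_ac)
      finally show "(\<Oplus>i\<in>{..<n}. regular_rep K n b (u I ?J) $$ (i, ?j) \<otimes> (b i \<otimes> d I))
        = b ?j \<otimes> (u I ?J \<otimes> d I)" .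
    qed (use uc dm[OF c] in \<open>auto simp: KF.b_carrier FE.b_carrier\<close>)
    also have "\<dots> = b ?j \<otimes> (\<Oplus>I\<in>{..<m}. u I ?J \<otimes> d I)"
      using uc dm[OF c] by (intro finsum_rdistr[symmetric]) (auto simp: KF.b_carrier FE.b_carrier)
    also have "\<dots> = b ?j \<otimes> (x \<otimes> d ?J)"
      using FE.mult_b_expand[OF x dm(2)[OF c]] by (simp add: u_def)
    also have "\<dots> = x \<otimes> e (\<sigma> c)"
      using dm[OF c] x c by (simp add: e KF.b_carrier FE.b_carrier FE.E_carrier m_lcomm)
    finally show ?thesis ..
  qed
  have \<sigma>_lt: "\<sigma> r < n * m \<longleftrightarrow> r < n * m" "inv_into UNIV \<sigma> r < n * m \<longleftrightarrow> r < n * m" for r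
    using permutes_in_image[OF \<sigma>, of r] permutes_in_image[OF permutes_inv[OF \<sigma>], of r] by simp_all
  have rep: "regular_rep K (n * m) e x = mat (n * m) (n * m) (\<lambda>(i, j). M (inv_into UNIV \<sigma> i) (inv_into UNIV \<sigma> j))"
    (is "_ = ?M")
  proof (rule KE.regular_rep_eqI[OF x])
    fix j assume j: "j < n * m"
    have "x \<otimes> e j = (\<Oplus>r\<in>{..<n * m}. M r (inv_into UNIV \<sigma> j) \<otimes> e (\<sigma> r))"
      using expand[of "inv_into UNIV \<sigma> j"] j by (simp add: \<sigma>_lt permutes_inverses[OF \<sigma>])
    also have "\<dots> = (\<Oplus>r\<in>{..<n * m}. ?M $$ (\<sigma> r, j) \<otimes> e (\<sigma> r))"
      using j Mc by (intro finsum_cong') (auto simp: \<sigma>_lt permutes_inverses[OF \<sigma>] KE.b_carrier)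
    also have "\<dots> = (\<Oplus>i\<in>\<sigma> ` {..<n * m}. ?M $$ (i, j) \<otimes> e i)"
      using j Mc permutes_inj_on[OF \<sigma>]
      by (intro finsum_reindex[symmetric]) (auto simp: \<sigma>_lt permutes_inverses[OF \<sigma>] KE.b_carrier)
    finally show "x \<otimes> e j = (\<Oplus>i\<in>{..<n * m}. ?M $$ (i, j) \<otimes> e i)"
      by (simp add: permutes_image[OF \<sigma>])
  qed (auto simp: M \<sigma>_lt)
  show ?thesis unfolding flat rep
    by (intro cong_mat) (auto simp: \<sigma>_lt permutes_inverses[OF \<sigma>])
qed

lemma (in cring) regular_rep_tower_conj:
  fixes \<sigma> :: "nat \<Rightarrow> nat"
  assumes "subring_basis R K F n b" and "subring_basis R F E m d" and "subring_basis R K E (n * m) e"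
    and \<sigma>: "\<sigma> permutes {..<n * m}"
    and e: "\<And>r. r < n * m \<Longrightarrow> e (\<sigma> r) = b (r mod n) \<otimes> d (r div n)"
  shows "\<exists>Q. permutation_matrix (R\<lparr>carrier := K\<rparr>) (n * m) Q \<and>
    (\<forall>x\<in>E. flatten_blocks m n (map_mat (regular_rep K n b) (regular_rep F m d x)) =
       Q \<otimes>\<^bsub>mat_algebra (R\<lparr>carrier := K\<rparr>) (n * m)\<^esub> regular_rep K (n * m) e x
         \<otimes>\<^bsub>mat_algebra (R\<lparr>carrier := K\<rparr>) (n * m)\<^esub> transpose_mat Q)"
proof -
  interpret KE: subring_basis R K E "n * m" e by fact
  interpret K: ring "R\<lparr>carrier := K\<rparr>" by (rule subring_is_ring[OF KE.K_subring])
  define Q where "Q = mat (n * m) (n * m) (\<lambda>(i, j). if i = inv_into UNIV \<sigma> j then \<one> else \<zero>)"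
  have "permutation_matrix (R\<lparr>carrier := K\<rparr>) (n * m) Q"
    unfolding permutation_matrix_def using permutes_inv[OF \<sigma>]
    by (intro exI[of _ "inv_into UNIV \<sigma>"]) (simp add: Q_def cong: if_cong)
  moreover have "flatten_blocks m n (map_mat (regular_rep K n b) (regular_rep F m d x)) =
       Q \<otimes>\<^bsub>mat_algebra (R\<lparr>carrier := K\<rparr>) (n * m)\<^esub> regular_rep K (n * m) e x
         \<otimes>\<^bsub>mat_algebra (R\<lparr>carrier := K\<rparr>) (n * m)\<^esub> transpose_mat Q" if x: "x \<in> E" for x
  proof -
    have "regular_rep K (n * m) e x \<in> carrier (mat_algebra (R\<lparr>carrier := K\<rparr>) (n * m))"
      using x KE.regular_rep_entry by (simp add: mat_algebra_def)
    from K.permutation_matrix_conj[OF \<sigma> this]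
    have "Q \<otimes>\<^bsub>mat_algebra (R\<lparr>carrier := K\<rparr>) (n * m)\<^esub> regular_rep K (n * m) e x
         \<otimes>\<^bsub>mat_algebra (R\<lparr>carrier := K\<rparr>) (n * m)\<^esub> transpose_mat Q
        = mat (n * m) (n * m) (\<lambda>(i, j). regular_rep K (n * m) e x $$ (\<sigma> i, \<sigma> j))"
      by (simp add: Q_def cong: if_cong)
    moreover have "flatten_blocks m n (map_mat (regular_rep K n b) (regular_rep F m d x))
        = mat (n * m) (n * m) (\<lambda>(i, j). regular_rep K (n * m) e x $$ (\<sigma> i, \<sigma> j))"
      by (rule regular_rep_tower[OF assms(1-3) \<sigma> _ x]) (rule e)
    ultimately show ?thesis by simp
  qed
  ultimately show ?thesis by blast
qed

section \<open>Compatible bases\<close>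

context prime_char_closed_field
begin

lemma frob_fixed_dvd_iff:
  assumes "k > 0" "l > 0"
  shows "frob_fixed k \<subseteq> frob_fixed l \<longleftrightarrow> k dvd l"
proof
  assume sub: "frob_fixed k \<subseteq> frob_fixed l"
  have "frob_fixed k \<subseteq> frob_fixed (gcd k l)" using frob_fixed_gcd sub by blast
  moreover have "frob_fixed (gcd k l) \<subseteq> frob_fixed k" by (rule frob_fixed_mono) simp
  ultimately have "card (frob_fixed k) = card (frob_fixed (gcd k l))" by (metis antisym)
  hence "p ^ k = p ^ gcd k l" using assms by (simp add: card_frob_fixed)
  hence "k = gcd k l" using p_gt_1 by (simp add: power_inject_exp)
  thus "k dvd l" by (metis gcd_dvd2)
qed (rule frob_fixed_mono)

lemma primepow_generator_exists:
  assumes "primepow (t::nat)"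
  shows "\<exists>x \<in> frob_fixed t. \<forall>k. x \<in> frob_fixed k \<longleftrightarrow> t dvd k"
proof -
  obtain l i where l: "Factorial_Ring.prime l" "i > 0" "t = l ^ i" 
    using assms by (auto simp: primepow_def)
  define s where "s = l ^ (i - 1)"
  have t: "t = l * s" using l(2) by (cases i) (auto simp: s_def l(3))
  have pos: "s > 0" "t > 0" using l(1) prime_gt_0_nat by (auto simp: s_def l(3))
  have "\<not> t dvd s" using pos l(1) prime_gt_1_nat[of l] by (auto simp: t dest!: dvd_imp_le)
  then obtain x where x: "x \<in> frob_fixed t" "x \<notin> frob_fixed s"
    using frob_fixed_dvd_iff[of t s] pos by blast
  have "t dvd k" if "x \<in> frob_fixed k" for k
  proof (rule ccontr)
    assume n: "\<not> t dvd k"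
    have "gcd t k dvd l ^ i" using l(3) by simp
    then obtain j where j: "j \<le> i" "gcd t k = l ^ j"
      using l(1) by (auto simp: divides_primepow_nat)
    have "j \<noteq> i" using n j l(3) by (metis gcd_dvd2)
    hence "gcd t k dvd s" using j by (auto simp: s_def intro: le_imp_power_dvd)
    thus False using frob_fixed_gcd[OF x(1) that] frob_fixed_mono x(2) by blast
  qed
  thus ?thesis using x(1) frob_fixed_mono by blast
qed

definition primepow_gen :: "nat \<Rightarrow> 'a" where
  "primepow_gen t = (SOME x. x \<in> frob_fixed t \<and> (\<forall>k. x \<in> frob_fixed k \<longleftrightarrow> t dvd k))"

lemma primepow_gen_mem_iff:
  "primepow t \<Longrightarrow> primepow_gen t \<in> frob_fixed k \<longleftrightarrow> t dvd k"
  using someI_ex[OF primepow_generator_exists[of t, unfolded Bex_def]] by (simp add: primepow_gen_def)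

lemma eval_rev_upt:
  assumes "\<And>i. i < n \<Longrightarrow> c i \<in> carrier R" and x: "x \<in> carrier R"
  shows "eval (map c (rev [0..<n])) x = (\<Oplus>i\<in>{..<n}. c i \<otimes> x [^] i)"
  using assms(1)
proof (induction n)
  case (Suc n)
  have "(\<Oplus>i\<in>{..<Suc n}. c i \<otimes> x [^] i) = c n \<otimes> x [^] n \<oplus> (\<Oplus>i\<in>{..<n}. c i \<otimes> x [^] i)"
    unfolding lessThan_Suc using Suc.prems x by (intro finsum_insert) auto
  thus ?case using Suc by simp
qed simp

lemma polynomial_roots_bound:
  assumes c: "\<And>i. i < n \<Longrightarrow> c i \<in> carrier R"
    and Y: "Y \<subseteq> carrier R" "finite Y" "card Y \<ge> n"
    and root: "\<And>y. y \<in> Y \<Longrightarrow> (\<Oplus>i\<in>{..<n}. c i \<otimes> y [^] i) = \<zero>" and i: "i < n"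
  shows "c i = \<zero>"
proof -
  define g where "g = map c (rev [0..<n])"
  have g: "set g \<subseteq> carrier R" using c by (auto simp: g_def)
  have ng: "normalize g \<in> carrier (poly_ring R)"
    using normalize_gives_polynomial[OF g] by (simp add: univ_poly_carrier)
  have "normalize g = []"
  proof (rule ccontr)
    assume ne: "normalize g \<noteq> []"
    have "Y \<subseteq> set_mset (roots (normalize g))"
    proof
      fix y assume y: "y \<in> Y"
      have "eval (normalize g) y = \<zero>"
        using eval_normalize[OF g, of y] eval_rev_upt[of n c y] root[OF y] c y Y by (auto simp: g_def)
      thus "y \<in> set_mset (roots (normalize g))"
        using ne y Y roots_mem_iff_is_root[OF ng] by (auto simp: is_root_def)
    qed
    hence "card Y \<le> card (set_mset (roots (normalize g)))" by (intro card_mono) auto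
    also have "\<dots> \<le> size (roots (normalize g))"
    proof -
      have "(\<Sum>y\<in>set_mset (roots (normalize g)). 1) \<le> (\<Sum>y\<in>set_mset (roots (normalize g)). count (roots (normalize g)) y)"
        by (intro sum_mono) (simp add: Suc_le_eq)
      thus ?thesis by (simp add: size_multiset_overloaded_eq)
    qed
    also have "\<dots> \<le> degree (normalize g)" by (rule size_roots_le_degree[OF ng])
    also have "\<dots> < length (normalize g)" using ne by simp
    also have "\<dots> \<le> length g" by (rule normalize_length_le)
    also have "\<dots> = n" by (simp add: g_def)
    finally show False using Y by simp
  qed
  hence "coeff g = coeff []" using normalize_coeff[of g] by simp
  moreover have "coeff g (length g - 1 - (n - 1 - i)) = g ! (n - 1 - i)"
    using i by (subst coeff_nth) (auto simp: g_def)
  ultimately show ?thesis using i by (simp add: g_def rev_nth)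
qed

lemma nat_pow_finsum_frobenius:
  assumes "finite I" "\<And>i. i \<in> I \<Longrightarrow> f i \<in> carrier R"
  shows "(\<Oplus>i\<in>I. f i) [^] (p ^ k) = (\<Oplus>i\<in>I. f i [^] (p ^ k))"
  using assms
proof (induction I rule: finite_induct)
  case empty
  thus ?case using p_pow_pos[of k] by (simp add: nat_pow_zero)
next
  case (insert i I)
  thus ?case by (simp add: Pi_def frobenius_pow_add)
qed

lemma powers_lin_indep:
  assumes k: "k > 0" and l: "Factorial_Ring.prime l"
    and y: "y \<in> frob_fixed (k * l)" "y \<notin> frob_fixed k"
  shows "lin_indep (frob_fixed k) {..<l} (\<lambda>i. y [^] i)"
  unfolding lin_indep_def
proof (intro ballI impI)
  fix c i assume c: "c \<in> {..<l} \<rightarrow> frob_fixed k" and z: "(\<Oplus>i\<in>{..<l}. c i \<otimes> y [^] i) = \<zero>"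
    and i: "i \<in> {..<l}"
  have yR: "y \<in> carrier R" using y by (simp add: frob_fixed_def)
  have cR: "c i \<in> carrier R" "c i [^] (p ^ (k * j)) = c i" if "i < l" for i j
    using c that frob_fixed_mono[of k "k * j"] by (auto simp: frob_fixed_def Pi_def subset_iff)
  define w where "w j = y [^] (p ^ (k * j))" for j
  have wR: "w j \<in> carrier R" for j using yR by (simp add: w_def)
  have inj: "inj_on w {..<l}"
  proof (rule linorder_inj_onI)
    fix a b assume ab: "a < b" "a \<in> {..<l}" "b \<in> {..<l}"
    show "w a \<noteq> w b"
    proof
      assume eq: "w a = w b"
      define v where "v = y [^] (p ^ (k * (b - a)))"
      have vR: "v \<in> carrier R" using yR by (simp add: v_def)
      have "k * b = k * (b - a) + k * a" using ab by (simp flip: distrib_left)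
      hence "w b = v [^] (p ^ (k * a))" using yR by (simp add: w_def v_def nat_pow_pow power_add)
      hence "v [^] (p ^ (k * a)) = y [^] (p ^ (k * a))" using eq unfolding w_def[of a] by metis
      hence "v = y" by (rule frobenius_pow_inj[OF vR yR])
      hence "y \<in> frob_fixed (k * (b - a))" using yR by (simp add: frob_fixed_def v_def)
      hence *: "y \<in> frob_fixed (gcd (k * l) (k * (b - a)))" using y(1) frob_fixed_gcd by blast
      have "\<not> l dvd b - a" using ab by (auto dest: dvd_imp_le)
      hence "coprime l (b - a)" using l prime_imp_coprime by blast
      hence "gcd l (b - a) = 1" by simp
      hence "gcd (k * l) (k * (b - a)) = k" using gcd_mult_distrib_nat[of k l "b - a"] by simp
      thus False using * y(2) by simp
    qed
  qed auto
  have root: "(\<Oplus>i\<in>{..<l}. c i \<otimes> w j [^] i) = \<zero>" for j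
  proof -
    have "\<zero> = (\<Oplus>i\<in>{..<l}. c i \<otimes> y [^] i) [^] (p ^ (k * j))"
      using z p_pow_pos[of "k * j"] by (simp add: nat_pow_zero)
    also have "\<dots> = (\<Oplus>i\<in>{..<l}. (c i \<otimes> y [^] i) [^] (p ^ (k * j)))"
      using cR yR by (intro nat_pow_finsum_frobenius) auto
    also have "\<dots> = (\<Oplus>i\<in>{..<l}. c i \<otimes> w j [^] i)"
      using cR yR by (intro finsum_cong') (auto simp: nat_pow_distrib w_def nat_pow_pow mult.commute)
    finally show ?thesis ..
  qed
  show "c i = \<zero>"
    by (rule polynomial_roots_bound[of l c "w ` {..<l}"])
      (use cR wR root i in \<open>auto simp: card_image[OF inj]\<close>)
qed

definition new_primepows :: "nat \<Rightarrow> nat \<Rightarrow> nat set" where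
  "new_primepows k N = {t. primepow t \<and> t dvd N \<and> \<not> t dvd k}"

definition monomials :: "nat set \<Rightarrow> 'a set" where
  "monomials I = (\<lambda>f. \<Otimes>t\<in>I. primepow_gen t [^] (f t)) `
     {f :: nat \<Rightarrow> nat. \<forall>t\<in>I. f t < aprimedivisor t}"

lemma finite_new_primepows: "N > 0 \<Longrightarrow> finite (new_primepows k N)"
  by (rule finite_subset[of _ "{..N}"]) (auto simp: new_primepows_def dest: dvd_imp_le)

lemma new_primepows_split:
  assumes "k dvd l" "l dvd N"
  shows "new_primepows k N = new_primepows k l \<union> new_primepows l N"
    "new_primepows k l \<inter> new_primepows l N = {}"
  using assms by (auto simp: new_primepows_def intro: dvd_trans)

lemma new_primepows_self: "new_primepows k k = {}"
  by (auto simp: new_primepows_def)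

lemma new_primepows_mult_prime:
  assumes k: "k > 0" and l: "Factorial_Ring.prime l"
  shows "new_primepows k (k * l) = {l ^ Suc (multiplicity l k)}"
proof (intro equalityI subsetI)
  fix t assume "t \<in> new_primepows k (k * l)"
  hence t: "primepow t" "t dvd k * l" "\<not> t dvd k" by (auto simp: new_primepows_def)
  obtain r i where r: "Factorial_Ring.prime r" "i > 0" "t = r ^ i"
    using t(1) by (auto simp: primepow_def)
  have "r = l"
  proof (rule ccontr)
    assume "r \<noteq> l"
    hence "coprime t l" using r l by (simp add: primes_coprime)
    thus False using t by (simp add: coprime_dvd_mult_left_iff)
  qed
  hence ti: "t = l ^ i" using r by simp
  have "i \<le> multiplicity l (k * l)"
    using t(2) k l by (intro multiplicity_geI) (auto simp: ti prime_gt_0_nat)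
  also have "\<dots> = Suc (multiplicity l k)"
    using k l by (simp add: prime_elem_multiplicity_mult_distrib prime_gt_0_nat)
  finally have "i \<le> Suc (multiplicity l k)" .
  moreover have "i > multiplicity l k"
    using t(3) unfolding ti by (meson multiplicity_dvd' not_le)
  ultimately have "i = Suc (multiplicity l k)" by simp
  thus "t \<in> {l ^ Suc (multiplicity l k)}" by (simp add: ti)
next
  fix t assume "t \<in> {l ^ Suc (multiplicity l k)}"
  hence t: "t = l ^ Suc (multiplicity l k)" by simp
  have "t dvd k * l" unfolding t by (simp add: multiplicity_dvd mult_dvd_mono mult.commute[of l])
  moreover have "\<not> t dvd k"
    unfolding t using k l by (metis Suc_n_not_le_n multiplicity_geI neq0_conv not_prime_unit)
  ultimately show "t \<in> new_primepows k (k * l)"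
    using l by (simp add: new_primepows_def t del: power_Suc)
qed

lemma primepow_gen_carrier: "primepow t \<Longrightarrow> primepow_gen t \<in> carrier R"
  using primepow_gen_mem_iff[of t t] frob_fixed_carrier by auto

lemma monomials_Un:
  assumes fin: "finite I" "finite J" and disj: "I \<inter> J = {}"
    and pp: "\<And>t. t \<in> I \<union> J \<Longrightarrow> primepow t"
  shows "monomials (I \<union> J) = (\<lambda>(x, y). x \<otimes> y) ` (monomials I \<times> monomials J)"
proof -
  define M where "M I f = (\<Otimes>t\<in>I. primepow_gen t [^] (f t))" for I and f :: "nat \<Rightarrow> nat"
  have mon: "monomials I = M I ` {f. \<forall>t\<in>I. f t < aprimedivisor t}" for I
    by (simp add: monomials_def M_def)
  have M_Un: "M (I \<union> J) f = M I f \<otimes> M J f" for f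
    unfolding M_def using fin disj pp by (intro finprod_Un_disjoint) (auto simp: primepow_gen_carrier)
  have M_cong: "M A f = M A g" if "A \<subseteq> I \<union> J" "\<And>t. t \<in> A \<Longrightarrow> f t = g t" for A f g
    unfolding M_def using that pp by (intro finprod_cong') (auto simp: primepow_gen_carrier subset_iff)
  show ?thesis
  proof (intro equalityI subsetI)
    fix z assume "z \<in> monomials (I \<union> J)"
    then obtain f where f: "\<forall>t\<in>I \<union> J. f t < aprimedivisor t" "z = M (I \<union> J) f"
      unfolding mon by blast
    have "(M I f, M J f) \<in> monomials I \<times> monomials J" using f(1) unfolding mon by blast
    thus "z \<in> (\<lambda>(x, y). x \<otimes> y) ` (monomials I \<times> monomials J)"
      by (rule rev_image_eqI) (simp add: f(2) M_Un)
  next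
    fix z assume "z \<in> (\<lambda>(x, y). x \<otimes> y) ` (monomials I \<times> monomials J)"
    then obtain f g where fg: "\<forall>t\<in>I. f t < aprimedivisor t" "\<forall>t\<in>J. g t < aprimedivisor t"
      "z = M I f \<otimes> M J g"
      unfolding mon by auto
    define h where "h t = (if t \<in> I then f t else g t)" for t
    have "M I f = M I h" by (rule M_cong) (auto simp: h_def)
    moreover have "M J g = M J h" using disj by (intro M_cong) (auto simp: h_def)
    ultimately have "z = M (I \<union> J) h" by (simp add: fg(3) M_Un)
    moreover have "\<forall>t\<in>I \<union> J. h t < aprimedivisor t" using fg by (auto simp: h_def)
    ultimately show "z \<in> monomials (I \<union> J)" unfolding mon by blast
  qed
qed

lemma monomials_empty: "monomials {} = {\<one>}"
  by (auto simp: monomials_def)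

lemma monomials_singleton:
  assumes "primepow t"
  shows "monomials {t} = (\<lambda>i. primepow_gen t [^] i) ` {..<aprimedivisor t}"
proof -
  have eq: "(\<Otimes>s\<in>{t}. primepow_gen s [^] (f s)) = primepow_gen t [^] f t" for f :: "nat \<Rightarrow> nat"
    using primepow_gen_carrier[OF assms] by simp
  show ?thesis
    unfolding monomials_def eq
    by (auto simp: image_iff intro: exI[of _ "\<lambda>_. i" for i])
qed

lemma frob_fixed_finprod:
  assumes "finite I" "\<And>i. i \<in> I \<Longrightarrow> f i \<in> frob_fixed k"
  shows "(\<Otimes>i\<in>I. f i) \<in> frob_fixed k"
  using assms
proof (induction I rule: finite_induct)
  case empty
  thus ?case using subringE(3)[OF frob_fixed_subring] by simp
next
  case (insert i I)
  have "f j \<in> carrier R" if "j \<in> insert i I" for j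
    using insert.prems[OF that] frob_fixed_carrier by auto
  hence "(\<Otimes>i\<in>insert i I. f i) = f i \<otimes> (\<Otimes>i\<in>I. f i)"
    using insert.hyps by (intro finprod_insert) auto
  thus ?case using insert subringE(6)[OF frob_fixed_subring] by simp
qed

lemma frob_fixed_nat_pow: "x \<in> frob_fixed k \<Longrightarrow> x [^] (i::nat) \<in> frob_fixed k"
  by (induction i) (auto intro: subringE(3,6)[OF frob_fixed_subring])

lemma monomials_frob_fixed:
  assumes "N > 0"
  shows "monomials (new_primepows k N) \<subseteq> frob_fixed N"
  using finite_new_primepows[OF assms]
  by (auto simp: monomials_def new_primepows_def primepow_gen_mem_iff
      intro!: frob_fixed_finprod frob_fixed_nat_pow)

lemma monomials_lin_indep:
  assumes "k > 0" "k dvd N" "N > 0"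
  shows "finite (monomials (new_primepows k N)) \<and> card (monomials (new_primepows k N)) = N div k
    \<and> lin_indep (frob_fixed k) (monomials (new_primepows k N)) (\<lambda>s. s)"
  using assms
proof (induction N rule: less_induct)
  case (less N)
  show ?case
  proof (cases "N = k")
    case True
    have "lin_indep (frob_fixed k) {\<one>} (\<lambda>s. s)"
      unfolding lin_indep_def
    proof (intro ballI impI)
      fix c i assume c: "c \<in> {\<one>} \<rightarrow> frob_fixed k" and z: "(\<Oplus>s\<in>{\<one>}. c s \<otimes> s) = \<zero>" and i: "i \<in> {\<one>}"
      have "c \<one> \<in> carrier R" using c frob_fixed_carrier[of k] by blast
      thus "c i = \<zero>" using z i by simp
    qed
    thus ?thesis
      using less.prems by (simp add: True new_primepows_self monomials_empty)
  next
    case False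
    hence "N div k \<noteq> 1" using less.prems by (auto simp: dvd_def)
    then obtain l where l: "Factorial_Ring.prime l" "l dvd N div k"
      using prime_factor_nat by blast
    obtain a where a: "N div k = l * a" using l(2) by blast
    define M where "M = k * a"
    have N: "N = M * l" using a less.prems by (metis M_def dvd_mult_div_cancel mult.assoc mult.commute)
    have lM: "l > 1" "M > 0" "k dvd M" "M < N"
      using l(1) prime_gt_1_nat N less.prems by (auto simp: M_def)
    define t where "t = l ^ Suc (multiplicity l M)"
    define y where "y = primepow_gen t"
    define S where "S = monomials (new_primepows k M)"
    have IH: "finite S" "card S = M div k" "lin_indep (frob_fixed k) S (\<lambda>s. s)"
      using less.IH[OF lM(4)] less.prems lM by (auto simp: S_def)
    have SM: "S \<subseteq> frob_fixed M" unfolding S_def by (rule monomials_frob_fixed[OF lM(2)])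
    have new: "new_primepows M N = {t}"
      unfolding N t_def by (rule new_primepows_mult_prime[OF lM(2) l(1)])
    hence t: "primepow t" "t dvd N" "\<not> t dvd M" by (auto simp: new_primepows_def)
    have apd: "aprimedivisor t = l" unfolding t_def using l(1) by (intro aprimedivisor_prime_power) auto
    have y: "y \<in> frob_fixed (M * l)" "y \<notin> frob_fixed M"
      using t by (auto simp: y_def primepow_gen_mem_iff N)
    hence yR: "y \<in> carrier R" using frob_fixed_carrier by auto
    have mon: "monomials (new_primepows k N) = (\<lambda>(s, i). s \<otimes> y [^] i) ` (S \<times> {..<l})"
    proof -
      have split: "new_primepows k N = new_primepows k M \<union> {t}"
        and disj: "new_primepows k M \<inter> {t} = {}"
        using new_primepows_split[OF lM(3), of N] new by (simp_all add: N)
      have "monomials (new_primepows k N) = (\<lambda>(x, y). x \<otimes> y) ` (S \<times> monomials {t})"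
        unfolding split S_def
        by (rule monomials_Un[OF finite_new_primepows[OF lM(2)] _ disj])
          (use t(1) in \<open>auto simp: new_primepows_def\<close>)
      also have "S \<times> monomials {t} = (\<lambda>(s, i). (s, y [^] i)) ` (S \<times> {..<l})"
        using image_paired_Times[of "\<lambda>s. s" "\<lambda>i. y [^] i" S "{..<l}"]
        by (simp add: monomials_singleton[OF t(1)] apd y_def)
      also have "(\<lambda>(x, y). x \<otimes> y) ` \<dots> = (\<lambda>(s, i). s \<otimes> y [^] i) ` (S \<times> {..<l})"
        by (simp add: image_image case_prod_unfold)
      finally show ?thesis .
    qed
    have indep: "lin_indep (frob_fixed k) (S \<times> {..<l}) (\<lambda>(s, i). s \<otimes> y [^] i)"
      using IH SM yR frob_fixed_mono[OF lM(3)] powers_lin_indep[OF lM(2) l(1) y]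
      by (intro lin_indep_tower[OF _ _ frob_fixed_subring[of M]]) auto
    have img: "(\<lambda>(s, i). s \<otimes> y [^] i) \<in> S \<times> {..<l} \<rightarrow> carrier R"
      using SM frob_fixed_carrier[of M] yR by auto
    have inj: "inj_on (\<lambda>(s, i). s \<otimes> y [^] i) (S \<times> {..<l})"
      by (rule lin_indep_imp_inj_on[OF _ frob_fixed_subring img indep]) (use IH in auto)
    have "lin_indep (frob_fixed k) (monomials (new_primepows k N)) (\<lambda>s. s)"
    proof (rule lin_indep_reindex[OF _ _ frob_fixed_carrier indep])
      show "bij_betw (\<lambda>(s, i). s \<otimes> y [^] i) (S \<times> {..<l}) (monomials (new_primepows k N))"
        using inj by (simp add: mon bij_betw_def)
      show "(\<lambda>s. s) \<in> monomials (new_primepows k N) \<rightarrow> carrier R"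
        using SM frob_fixed_carrier[of M] yR by (auto simp: mon intro!: m_closed)
    qed simp
    moreover have "card (monomials (new_primepows k N)) = N div k"
      unfolding mon card_image[OF inj] using IH N lM(3) by (simp add: card_cartesian_product div_mult_swap mult.commute)
    ultimately show ?thesis using IH(1) by (simp add: mon)
  qed
qed

definition monomial_basis :: "nat \<Rightarrow> nat \<Rightarrow> nat \<Rightarrow> 'a" where
  "monomial_basis k N = (SOME b. bij_betw b {..<N div k} (monomials (new_primepows k N)))"

lemma monomial_basis_bij:
  assumes "k > 0" "n > 0"
  shows "bij_betw (monomial_basis k (k * n)) {..<n} (monomials (new_primepows k (k * n)))"
proof -
  have "\<exists>b. bij_betw b {..<n} (monomials (new_primepows k (k * n)))"
    using monomials_lin_indep[of k "k * n"] assms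
    by (intro finite_same_card_bij) auto
  from someI_ex[OF this] show ?thesis using assms by (simp add: monomial_basis_def)
qed

lemma subring_basis_monomial_basis:
  assumes "k > 0" "n > 0"
  shows "subring_basis R (frob_fixed k) (frob_fixed (k * n)) n (monomial_basis k (k * n))"
proof -
  note bij = monomial_basis_bij[OF assms]
  note indep = monomials_lin_indep[of k "k * n"]
  have mem: "monomial_basis k (k * n) \<in> {..<n} \<rightarrow> frob_fixed (k * n)"
    using bij_betwE[OF bij] monomials_frob_fixed[of "k * n" k] assms by auto
  have "lin_indep (frob_fixed k) {..<n} (monomial_basis k (k * n))"
  proof (rule lin_indep_reindex[OF bij_betw_inv_into[OF bij]])
    show "lin_indep (frob_fixed k) (monomials (new_primepows k (k * n))) (\<lambda>s. s)"
      using indep assms by simp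
  qed (use bij_betw_inv_into_right[OF bij] mem frob_fixed_carrier in auto)
  hence "is_basis (frob_fixed k) (frob_fixed (k * n)) n (monomial_basis k (k * n))"
    using mem assms
    by (intro lin_indep_imp_is_basis frob_fixed_subring frob_fixed_mono finite_frob_fixed)
      (auto simp: card_frob_fixed power_mult)
  thus ?thesis
    using frob_fixed_mono[of k "k * n"]
    by (intro subring_basis.intro subring_basis_axioms.intro is_cring frob_fixed_subring) auto
qed

lemma monomial_basis_tower:
  assumes "k > 0" "n > 0" "m > 0"
  obtains \<tau> where "\<tau> permutes {..<n * m}"
    "\<And>r. r < n * m \<Longrightarrow> monomial_basis k (k * (n * m)) (\<tau> r)
       = monomial_basis k (k * n) (r mod n) \<otimes> monomial_basis (k * n) (k * n * m) (r div n)"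
proof -
  let ?b = "monomial_basis k (k * n)" and ?d = "monomial_basis (k * n) (k * n * m)"
    and ?e = "monomial_basis k (k * (n * m))"
  define g where "g r = ?b (r mod n) \<otimes> ?d (r div n)" for r
  have b: "bij_betw ?b {..<n} (monomials (new_primepows k (k * n)))"
    using assms by (intro monomial_basis_bij)
  have d: "bij_betw ?d {..<m} (monomials (new_primepows (k * n) (k * n * m)))"
    using assms by (intro monomial_basis_bij) auto
  have e: "bij_betw ?e {..<n * m} (monomials (new_primepows k (k * (n * m))))"
    using assms by (intro monomial_basis_bij) auto
  have mon: "monomials (new_primepows k (k * (n * m))) =
    (\<lambda>(x, y). x \<otimes> y) ` (monomials (new_primepows k (k * n)) \<times> monomials (new_primepows (k * n) (k * n * m)))"
  proof -
    have split: "new_primepows k (k * (n * m)) = new_primepows k (k * n) \<union> new_primepows (k * n) (k * n * m)"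
      and disj: "new_primepows k (k * n) \<inter> new_primepows (k * n) (k * n * m) = {}"
      using new_primepows_split[of k "k * n" "k * n * m"] by (simp_all add: mult.assoc)
    show ?thesis unfolding split
      by (rule monomials_Un[OF finite_new_primepows finite_new_primepows disj])
        (use assms in \<open>auto simp: new_primepows_def\<close>)
  qed
  have img: "g ` {..<n * m} = ?e ` {..<n * m}"
    unfolding bij_betw_imp_surj_on[OF e] mon
  proof (intro equalityI subsetI)
    fix x assume "x \<in> g ` {..<n * m}"
    then obtain r where r: "r < n * m" "x = g r" by auto
    have "r mod n \<in> {..<n}" "r div n \<in> {..<m}"
      using r(1) assms by (auto simp: less_mult_imp_div_less mult.commute)
    thus "x \<in> (\<lambda>(x, y). x \<otimes> y) ` (monomials (new_primepows k (k * n)) \<times> monomials (new_primepows (k * n) (k * n * m)))"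
      using bij_betwE[OF b] bij_betwE[OF d]
      by (intro rev_image_eqI[of "(?b (r mod n), ?d (r div n))"]) (auto simp: r(2) g_def)
  next
    fix x assume "x \<in> (\<lambda>(x, y). x \<otimes> y) ` (monomials (new_primepows k (k * n)) \<times> monomials (new_primepows (k * n) (k * n * m)))"
    then obtain u v where uv: "u \<in> ?b ` {..<n}" "v \<in> ?d ` {..<m}" "x = u \<otimes> v"
      unfolding bij_betw_imp_surj_on[OF b] bij_betw_imp_surj_on[OF d] by auto
    then obtain i I where iI: "i < n" "I < m" "x = ?b i \<otimes> ?d I" by auto
    have "I * n + i < Suc I * n" using iI by simp
    also have "\<dots> \<le> m * n" using iI by (intro mult_right_mono) auto
    finally have "I * n + i < n * m" by (simp add: mult.commute)
    moreover have "g (I * n + i) = x" using iI by (simp add: g_def)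
    ultimately show "x \<in> g ` {..<n * m}" by blast
  qed
  have inj: "inj_on g {..<n * m}"
    using img card_image[OF bij_betw_imp_inj_on[OF e]] by (intro eq_card_imp_inj_on) auto
  define \<tau> where "\<tau> r = (if r < n * m then inv_into {..<n * m} ?e (g r) else r)" for r
  have bij: "bij_betw (inv_into {..<n * m} ?e \<circ> g) {..<n * m} {..<n * m}"
    using inj img bij_betw_inv_into[OF e] bij_betw_imp_surj_on[OF e]
    by (intro bij_betw_trans[of g _ "?e ` {..<n * m}"]) (auto simp: bij_betw_def)
  have "\<tau> permutes {..<n * m}"
    by (rule bij_imp_permutes[OF bij_betw_cong[THEN iffD1, OF _ bij]]) (auto simp: \<tau>_def)
  moreover have "?e (\<tau> r) = g r" if "r < n * m" for r
  proof -
    have "g r \<in> ?e ` {..<n * m}" using that img by auto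
    thus ?thesis using that by (simp add: \<tau>_def f_inv_into_f)
  qed
  ultimately show ?thesis using that by (simp add: g_def)
qed

definition field_rep :: "nat \<Rightarrow> nat \<Rightarrow> 'a \<Rightarrow> 'a mat" where
  "field_rep k n = regular_rep (frob_fixed k) n (monomial_basis k (k * n))"

lemma field_rep_algebra_hom:
  assumes "k > 0" "n > 0"
  shows "field_rep k n \<in> algebra_hom (R\<lparr>carrier := frob_fixed k\<rparr>)
      (field_algebra (R\<lparr>carrier := frob_fixed (k * n)\<rparr>)) (mat_algebra (R\<lparr>carrier := frob_fixed k\<rparr>) n)"
    and "inj_on (field_rep k n) (frob_fixed (k * n))"
  using subring_basis.regular_rep_algebra_hom[OF subring_basis_monomial_basis[OF assms]]
    subring_basis.regular_rep_inj[OF subring_basis_monomial_basis[OF assms]]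
  by (simp_all add: field_rep_def)

lemma field_rep_tower:
  assumes "k > 0" "n > 0" "m > 0"
  shows "\<exists>Q. permutation_matrix (R\<lparr>carrier := frob_fixed k\<rparr>) (n * m) Q \<and>
    (\<forall>x\<in>frob_fixed (k * (n * m)). flatten_blocks m n (map_mat (field_rep k n) (field_rep (k * n) m x)) =
       Q \<otimes>\<^bsub>mat_algebra (R\<lparr>carrier := frob_fixed k\<rparr>) (n * m)\<^esub> field_rep k (n * m) x
         \<otimes>\<^bsub>mat_algebra (R\<lparr>carrier := frob_fixed k\<rparr>) (n * m)\<^esub> transpose_mat Q)"
proof -
  obtain \<tau> where \<tau>: "\<tau> permutes {..<n * m}"
    "\<And>r. r < n * m \<Longrightarrow> monomial_basis k (k * (n * m)) (\<tau> r)
       = monomial_basis k (k * n) (r mod n) \<otimes> monomial_basis (k * n) (k * n * m) (r div n)"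
    using monomial_basis_tower[OF assms] by blast
  have 1: "subring_basis R (frob_fixed k) (frob_fixed (k * n)) n (monomial_basis k (k * n))"
    using assms by (intro subring_basis_monomial_basis)
  have 2: "subring_basis R (frob_fixed (k * n)) (frob_fixed (k * (n * m))) m (monomial_basis (k * n) (k * n * m))"
    using subring_basis_monomial_basis[of "k * n" m] assms by (simp add: mult.assoc)
  have 3: "subring_basis R (frob_fixed k) (frob_fixed (k * (n * m))) (n * m) (monomial_basis k (k * (n * m)))"
    using assms by (intro subring_basis_monomial_basis) auto
  show ?thesis
    unfolding field_rep_def by (rule regular_rep_tower_conj[OF 1 2 3 \<tau>(1)]) (rule \<tau>(2))
qed

end

lemma alg_closure_of_prime_field_imp_closed:
  assumes p: "Factorial_Ring.prime p" and R: "alg_closure_of_prime_field p R"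
  shows "prime_char_closed_field R p"
proof -
  obtain h where h: "h \<in> Ring.ring_hom (residue_ring (int p)) R"
    and cl: "algebraic_closure R (h ` carrier (residue_ring (int p)))"
    using R by (auto simp: alg_closure_of_prime_field_def)
  interpret algebraic_closure R "h ` carrier (residue_ring (int p))" by (rule cl)
  interpret Z: residues "int p" "residue_ring (int p)"
    using prime_gt_1_nat[OF p] by unfold_locales auto
  interpret h: ring_hom_ring "residue_ring (int p)" R h
    by (rule ring_hom_ringI2[OF Z.ring_axioms ring_axioms h])
  have "[j] \<cdot>\<^bsub>R\<^esub> \<one>\<^bsub>R\<^esub> = h (int j mod int p)" for j :: nat
  proof (induction j)
    case 0
    thus ?case using h.hom_zero by (simp add: Z.res_zero_eq)
  next
    case (Suc j)
    have c: "int j mod int p \<in> carrier (residue_ring (int p))" "1 \<in> carrier (residue_ring (int p))"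
      using p prime_gt_1_nat[OF p] by (auto simp: Z.res_carrier_eq)
    have "[Suc j] \<cdot>\<^bsub>R\<^esub> \<one>\<^bsub>R\<^esub> = h (int j mod int p) \<oplus>\<^bsub>R\<^esub> h 1"
      using h.hom_one by (simp add: Suc Z.res_one_eq)
    also have "\<dots> = h ((int j mod int p + 1) mod int p)"
      using h.hom_add[OF c] by (simp add: Z.res_add_eq)
    finally show ?case by (simp add: mod_simps add.commute)
  qed
  from this[of p] have "[p] \<cdot>\<^bsub>R\<^esub> \<one>\<^bsub>R\<^esub> = \<zero>\<^bsub>R\<^esub>"
    using h.hom_zero by (simp add: Z.res_zero_eq)
  thus ?thesis using p by unfold_locales auto
qed

lemma GF_prime_power:
  assumes "prime_char_closed_field (L p) p" "k > 0"
  shows "GF L (p ^ k) = (L p)\<lparr>carrier := prime_char_field.frob_fixed (L p) p k\<rparr>"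
proof -
  interpret prime_char_closed_field "L p" p by fact
  have "aprimedivisor (p ^ k) = p" using assms(2) prime_p by (intro aprimedivisor_prime_power)
  thus ?thesis using subfield_card_unique[OF assms(2)] by (simp add: GF_def Let_def)
qed

theorem theorem1:
  fixes L :: "nat \<Rightarrow> ('a, 'b) ring_scheme"
  assumes closure: "\<And>p. Factorial_Ring.prime p \<Longrightarrow> alg_closure_of_prime_field p (L p)"
  shows "\<exists>\<rho> :: nat \<Rightarrow> nat \<Rightarrow> 'a \<Rightarrow> 'a mat.
    (\<forall>q n. primepow q \<and> n \<ge> 1 \<longrightarrow>
       \<rho> q n \<in> algebra_hom (GF L q) (field_algebra (GF L (q ^ n))) (mat_algebra (GF L q) n) \<and>
       inj_on (\<rho> q n) (carrier (GF L (q ^ n)))) \<and>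
    (\<forall>q m n. primepow q \<and> m \<ge> 1 \<and> n \<ge> 1 \<longrightarrow>
       (\<exists>Q. permutation_matrix (GF L q) (n * m) Q \<and>
         (\<forall>\<xi> \<in> carrier (GF L (q ^ (n * m))).
            flatten_blocks m n (map_mat (\<rho> q n) (\<rho> (q ^ n) m \<xi>)) =
              Q \<otimes>\<^bsub>mat_algebra (GF L q) (n * m)\<^esub> \<rho> q (n * m) \<xi>
                \<otimes>\<^bsub>mat_algebra (GF L q) (n * m)\<^esub> transpose_mat Q)))"
proof -
  define \<rho> where "\<rho> q n = prime_char_closed_field.field_rep (L (aprimedivisor q)) (aprimedivisor q)
    (multiplicity (aprimedivisor q) q) n" for q n :: nat
  have closed: "prime_char_closed_field (L p) p" if "Factorial_Ring.prime p" for p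
    using alg_closure_of_prime_field_imp_closed closure that by blast
  have \<rho>: "\<rho> (p ^ k) n = prime_char_closed_field.field_rep (L p) p k n"
    if "Factorial_Ring.prime p" "k > 0" for p k n :: nat
  proof -
    have "aprimedivisor (p ^ k) = p" using that by (intro aprimedivisor_prime_power)
    moreover have "multiplicity p (p ^ k) = k" using that by (simp add: prime_gt_0_nat)
    ultimately show ?thesis by (simp add: \<rho>_def)
  qed
  show ?thesis
  proof (intro exI[of _ \<rho>] conjI allI impI; elim conjE)
    fix q n :: nat assume q: "primepow q" and n: "n \<ge> 1"
    obtain p k where pk: "Factorial_Ring.prime p" "k > 0" "q = p ^ k"
      using q by (auto simp: primepow_def)
    interpret prime_char_closed_field "L p" p by (rule closed[OF pk(1)])
    have GF: "GF L q = (L p)\<lparr>carrier := frob_fixed k\<rparr>"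
      "GF L (q ^ n) = (L p)\<lparr>carrier := frob_fixed (k * n)\<rparr>"
      using GF_prime_power[where L = L and p = p, OF closed[OF pk(1)]] pk n by (simp_all flip: power_mult)
    show "\<rho> q n \<in> algebra_hom (GF L q) (field_algebra (GF L (q ^ n))) (mat_algebra (GF L q) n)"
      unfolding GF unfolding pk(3) \<rho>[OF pk(1,2)] using field_rep_algebra_hom(1)[of k n] pk n by simp
    show "inj_on (\<rho> q n) (carrier (GF L (q ^ n)))"
      unfolding GF unfolding pk(3) \<rho>[OF pk(1,2)] using field_rep_algebra_hom(2)[of k n] pk n by simp
  next
    fix q m n :: nat assume q: "primepow q" and m: "m \<ge> 1" and n: "n \<ge> 1"
    obtain p k where pk: "Factorial_Ring.prime p" "k > 0" "q = p ^ k"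
      using q by (auto simp: primepow_def)
    interpret prime_char_closed_field "L p" p by (rule closed[OF pk(1)])
    have GF: "GF L q = (L p)\<lparr>carrier := frob_fixed k\<rparr>"
      "GF L (q ^ (n * m)) = (L p)\<lparr>carrier := frob_fixed (k * (n * m))\<rparr>"
      using GF_prime_power[where L = L and p = p, OF closed[OF pk(1)]] pk n m by (simp_all flip: power_mult)
    have \<rho>': "\<rho> q n' = field_rep k n'" "\<rho> (q ^ n) m = field_rep (k * n) m" for n'
      using \<rho> pk n by (simp_all flip: power_mult)
    show "\<exists>Q. permutation_matrix (GF L q) (n * m) Q \<and>
         (\<forall>\<xi> \<in> carrier (GF L (q ^ (n * m))).
            flatten_blocks m n (map_mat (\<rho> q n) (\<rho> (q ^ n) m \<xi>)) =
              Q \<otimes>\<^bsub>mat_algebra (GF L q) (n * m)\<^esub> \<rho> q (n * m) \<xi>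
                \<otimes>\<^bsub>mat_algebra (GF L q) (n * m)\<^esub> transpose_mat Q)"
      unfolding GF \<rho>' using field_rep_tower[of k n m] pk n m by simp
  qed
qed

end
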